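(* Let $T$ be a tree of order at least $3$. Then $\mathrm{gp}_{\mathrm g}'(T)=\ell(T)-\Delta(T)+2$ if and only if $T\in\mathcal{T}$.
   Context: All graphs are finite, simple and undirected. $\ell(T)$ is the number of leaves (vertices of degree $1$) of $T$, and $\Delta(T)$ is its maximum degree. For $k\ge 2$ and non-negative integers $t_1,\dots,t_k$, $T_{t_1,\dots,t_k}$ denotes the tree obtained from the path of order $k$ by respectively attaching $t_1,\dots,t_k$ leaves to its consecutive vertices. Let $\mathcal{T}'=\{T_{t_1,\dots,t_k}: k\ge 2,\ t_1\ge 1,\ t_k\ge \sum_{i=1}^{k-1}t_i\}$. Let $\mathcal{T}$ be the family of trees containing all the stars $K_{1,n}$, $n\ge 2$, and all the trees that can be obtained from some tree in $\mathcal{T}'$ by subdividing each of its edges an arbitrary number of times (possibly zero). A set $S\subseteq V(G)$ is in general position if no shortest path of $G$ contains more than two vertices of $S$. In the Builder-Blocker general position game on a graph $G$, two players, Builder and Blocker, alternately choose (mark) an unmarked vertex of $G$ so that at each stage the set of all marked vertices is in general position; the game ends when no further vertex can be selected. Builder aims to make the final set of marked vertices as large as possible, Blocker as small as possible. In the B'-game Blocker moves first. $\mathrm{gp}_{\mathrm g}'(G)$ is the number of vertices in the final set when the B'-game is played optimally by both players. *)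

theory Defs
  imports "Graph_Theory.Graph_Theory"
begin

text \<open>
  Finite simple undirected graphs are the graphs of the locale \<open>pair_graph\<close>: each edge
  \<open>uv\<close> is represented by the two arcs \<open>(u, v)\<close> and \<open>(v, u)\<close>.
  Consequently \<open>out_degree\<close> is the usual degree.  The library predicate \<open>tree\<close> is not usable
  here: it counts \<open>u, v, u\<close> as a cycle.  The cycles of the undirected graph are the directed
  cycles of length at least 3.
\<close>

definition undirected_tree :: "'a pair_pre_digraph \<Rightarrow> bool" where
  "undirected_tree T \<longleftrightarrow>
     pair_graph T \<and> connected (with_proj T) \<and>
     \<not> (\<exists>p. pre_digraph.cycle (with_proj T) p \<and> 3 \<le> length p)"

definition num_leaves :: "'a pair_pre_digraph \<Rightarrow> nat" where
  "num_leaves G = card {v \<in> pverts G. out_degree (with_proj G) v = 1}"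

definition max_degree :: "'a pair_pre_digraph \<Rightarrow> nat" where
  "max_degree G = Max (out_degree (with_proj G) ` pverts G)"


section \<open>The Builder-Blocker general position game\<close>

definition shortest_path :: "'a pair_pre_digraph \<Rightarrow> 'a vwalk \<Rightarrow> bool" where
  "shortest_path G p \<longleftrightarrow>
     vpath p (with_proj G) \<and>
     (\<forall>q. vpath q (with_proj G) \<and> hd q = hd p \<and> last q = last p
        \<longrightarrow> vwalk_length p \<le> vwalk_length q)"

definition general_position :: "'a pair_pre_digraph \<Rightarrow> 'a set \<Rightarrow> bool" where
  "general_position G S \<longleftrightarrow>
     S \<subseteq> pverts G \<and> (\<forall>p. shortest_path G p \<longrightarrow> card (set p \<inter> S) \<le> 2)"

definition legal_moves :: "'a pair_pre_digraph \<Rightarrow> 'a set \<Rightarrow> 'a set" where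
  "legal_moves G S = {v \<in> pverts G - S. general_position G (insert v S)}"

datatype player = Builder | Blocker

fun opponent :: "player \<Rightarrow> player" where
  "opponent Builder = Blocker"
| "opponent Blocker = Builder"

text \<open>
  The number of finally marked vertices under optimal play, when the vertices in \<open>S\<close> are marked
  and it is the turn of the given player.  The finiteness test only serves to make the
  recursion terminate.
\<close>

function game_value :: "'a pair_pre_digraph \<Rightarrow> player \<Rightarrow> 'a set \<Rightarrow> nat" where
  "game_value G P S =
     (if infinite (pverts G) \<or> legal_moves G S = {} then card S
      else (case P of Builder \<Rightarrow> Max | Blocker \<Rightarrow> Min)
             ((\<lambda>v. game_value G (opponent P) (insert v S)) ` legal_moves G S))"
  by pat_completeness auto
termination
proof (relation "measure (\<lambda>(G, P, S). card (pverts G - S))", goal_cases)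
  case (2 G P S v)
  then have "pverts G - insert v S \<subset> pverts G - S" and "finite (pverts G - S)"
    by (auto simp: legal_moves_def)
  then show ?case
    by (simp add: psubset_card_mono)
qed simp

declare game_value.simps [simp del]

definition gp_game' :: "'a pair_pre_digraph \<Rightarrow> nat" where
  "gp_game' G = game_value G Blocker {}"


section \<open>The family of trees\<close>

text \<open>
  For \<open>ts = [t\<^sub>1, \<dots>, t\<^sub>k]\<close>, the \<open>i\<close>-th path vertex (counted from 0) is \<open>(i, 0)\<close>,
  and the leaves attached to it are \<open>(i, 1), \<dots>, (i, ts ! i)\<close>.
\<close>

definition caterpillar :: "nat list \<Rightarrow> (nat \<times> nat) pair_pre_digraph" where
  "caterpillar ts =
     \<lparr> pverts = {(i, j). i < length ts \<and> j \<le> ts ! i},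
       parcs = (let E = {((i, 0), (Suc i, 0)) | i. Suc i < length ts}
                      \<union> {((i, 0), (i, j)) | i j. i < length ts \<and> 1 \<le> j \<and> j \<le> ts ! i}
                in E \<union> E\<inverse>) \<rparr>"

lemma pair_graph_caterpillar: "pair_graph (caterpillar ts)"
proof -
  have fin: "finite (pverts (caterpillar ts))"
  proof (rule finite_subset)
    show "pverts (caterpillar ts) \<subseteq> Sigma {..<length ts} (\<lambda>i. {..ts ! i})"
      by (auto simp: caterpillar_def)
  qed auto
  have sub: "parcs (caterpillar ts) \<subseteq> pverts (caterpillar ts) \<times> pverts (caterpillar ts)"
    by (auto simp: caterpillar_def Let_def)
  have "finite (parcs (caterpillar ts))"
    using fin sub by (blast intro: finite_subset)
  moreover have "sym (parcs (caterpillar ts))"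
    by (auto simp: caterpillar_def Let_def intro: symI)
  moreover have "fst e \<noteq> snd e" if "e \<in> parcs (caterpillar ts)" for e
    using that by (auto simp: caterpillar_def Let_def)
  ultimately show ?thesis
    using fin sub by unfold_locales (auto simp: symmetric_def)
qed

text \<open>\<open>in_family_T'\<close> and \<open>in_family_T\<close> are membership in \<open>\<T>'\<close> and in \<open>\<T>\<close>, the latter up
  to isomorphism.\<close>

definition in_family_T' :: "(nat \<times> nat) pair_pre_digraph \<Rightarrow> bool" where
  "in_family_T' G \<longleftrightarrow>
     (\<exists>ts. 2 \<le> length ts \<and> 1 \<le> hd ts \<and> sum_list (butlast ts) \<le> last ts \<and> G = caterpillar ts)"

definition in_family_T :: "'a pair_pre_digraph \<Rightarrow> bool" where
  "in_family_T T \<longleftrightarrow>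
     (\<exists>n\<ge>2. K\<^bsub>1,n\<^esub> (with_proj T)) \<or>
     (\<exists>G H. in_family_T' G \<and> subdivision_pair G H \<and> digraph_iso (with_proj H) (with_proj T))"

end

theory Submission
  imports Defs
begin

text \<open>
  In a tree a set is in general position iff no member separates two others.  Suppose that Blocker
  starts with \<open>v\<close> and Builder answers \<open>u\<close>.  Then \<open>v\<close> must not separate any two later
  vertices, so the play stays in the branch of \<open>v\<close> that contains \<open>u\<close>.  Seen from \<open>v\<close>, different
  marked vertices have disjoint sets of vertices behind them, and each of these sets contains a
  leaf.  Hence the final set has at most one element more than the branch has leaves
  (\<open>card_general_position_le\<close>).  Each of the other \<open>deg v - 1\<close> branches contains a leaf as well, so
  starting at a vertex of maximum degree gives the upper bound \<open>\<ell> - \<Delta> + 2\<close> (\<open>gp_game'_le\<close>).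

  If the bound is attained, Blocker cannot make Builder lose a leaf.  Let \<open>v\<close> have maximum degree
  and let \<open>u\<close> be a good answer.  A branch vertex (a vertex of degree at least 3) has two leaves
  behind it; if it lay off the path from \<open>v\<close> to \<open>u\<close>, then either one of the lost branches would
  have two leaves, or two leaves would lie behind \<open>u\<close>, or Blocker could mark it next.  So all branch
  vertices lie on that path.  A second opening, at the lowest vertex that has all leaves of the
  branch of \<open>u\<close> behind it, then forces \<open>\<ell> + 2 \<le> 2 \<Delta>\<close> (\<open>spine_if_game_large\<close>).

  Conversely, let a path that starts in \<open>z\<close> contain all branch vertices, and let
  \<open>\<ell> + 2 \<le> 2 deg z\<close>.  Builder answers with a leaf beyond the other end of the path, unless Blocker
  has started in the branch of \<open>z\<close> that contains this leaf; in that case Builder answers with a leaf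
  of another branch of \<open>z\<close>.  In either case each of sufficiently many leaves ends up behind its own
  marked vertex (\<open>game_large_if_spine\<close>).  At least \<open>\<ell> - deg z + 2\<close> vertices are marked in this way,
  and this number is not below the upper bound.

  It remains to see that the existence of such a path, a \<open>heavy_ended_spine\<close>, describes the
  family.  It holds for the stars and caterpillars in question and survives subdivision and isomorphism
  (\<open>spine_if_in_family\<close>).  In the other direction, suppressing vertices of degree 2 one after the
  other ends in a caterpillar, unless the tree is a star (\<open>in_family_if_spine\<close>).
\<close>

section \<open>Separation in trees\<close>

definition nbrs :: "'a pair_pre_digraph \<Rightarrow> 'a \<Rightarrow> 'a set" where
  "nbrs G v = {x. (v, x) \<in> parcs G}"

abbreviation deg :: "'a pair_pre_digraph \<Rightarrow> 'a \<Rightarrow> nat" where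
  "deg G v \<equiv> out_degree (with_proj G) v"

lemma deg_eq_card_nbrs: "deg G v = card (nbrs G v)"
proof -
  have "out_arcs (with_proj G) v = Pair v ` nbrs G v"
    by (auto simp: out_arcs_def nbrs_def)
  then show ?thesis
    by (simp add: out_degree_def card_image inj_on_def)
qed

definition leaves :: "'a pair_pre_digraph \<Rightarrow> 'a set" where
  "leaves G = {v \<in> pverts G. deg G v = 1}"

lemma num_leaves_eq_card: "num_leaves G = card (leaves G)"
  by (simp add: num_leaves_def leaves_def)

text \<open>
  The vertices \<open>a\<close> and \<open>c\<close> lie in the same component of \<open>G - m\<close>.  In a tree, for distinct \<open>a\<close>, \<open>m\<close>
  and \<open>c\<close>, this fails iff \<open>m\<close> lies on the path from \<open>a\<close> to \<open>c\<close>; betweenness is phrased with this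
  relation, which is an equivalence on the other vertices.
\<close>

definition joined :: "'a pair_pre_digraph \<Rightarrow> 'a \<Rightarrow> 'a \<Rightarrow> 'a \<Rightarrow> bool" where
  "joined G m a c \<longleftrightarrow> (a, c) \<in> (parcs G \<inter> (- {m}) \<times> (- {m}))\<^sup>*"

text \<open>
  For a tree rooted at \<open>v\<close> and \<open>s \<noteq> v\<close> these are the descendants of \<open>s\<close>, with \<open>s\<close> among them.  If
  \<open>s\<close> is a neighbour of \<open>v\<close>, it is the branch of \<open>v\<close> at \<open>s\<close>.
\<close>

definition beyond :: "'a pair_pre_digraph \<Rightarrow> 'a \<Rightarrow> 'a \<Rightarrow> 'a set" where
  "beyond G v s = {x \<in> pverts G. \<not> joined G s v x}"

text \<open>
  Acyclicity in the form in which it is used: deleting a vertex separates its neighbours from each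
  other.  Unlike the absence of cycles, this is easily transferred to a tree in which a vertex of
  degree 2 is suppressed.
\<close>

locale tree_graph = pair_graph T for T :: "'a pair_pre_digraph" +
  assumes linked: "a \<in> pverts T \<Longrightarrow> c \<in> pverts T \<Longrightarrow> (a, c) \<in> (parcs T)\<^sup>*"
    and separates: "(m, x) \<in> parcs T \<Longrightarrow> (m, y) \<in> parcs T \<Longrightarrow> x \<noteq> y \<Longrightarrow> \<not> joined T m x y"

subsection \<open>Walks as lists of vertices\<close>

lemma vwalk_Cons_Cons_iff:
  "vwalk (a # b # p) (with_proj G) \<longleftrightarrow>
    a \<in> pverts G \<and> (a, b) \<in> parcs G \<and> vwalk (b # p) (with_proj G)"
  by (auto simp: vwalk_def)

lemma vwalk_imp_rtrancl:
  assumes "vwalk p (with_proj G)"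
  shows "(hd p, last p) \<in> (parcs G \<inter> set p \<times> set p)\<^sup>*"
  using assms
proof (induction p rule: vwalk_induct)
  case (Cons u v es)
  then have "(v, last (v # es)) \<in> (parcs G \<inter> set (u # v # es) \<times> set (u # v # es))\<^sup>*"
    by (auto elim!: rtrancl_mono[THEN subsetD, rotated])
  with Cons show ?case
    by (auto intro!: converse_rtrancl_into_rtrancl[of u v])
qed auto

lemma rtrancl_imp_vpath:
  assumes "(a, c) \<in> (parcs G \<inter> A \<times> A)\<^sup>*" and "a \<in> pverts G" "a \<in> A" and "pair_graph G"
  obtains p where "vpath p (with_proj G)" "hd p = a" "last p = c" "set p \<subseteq> A"
proof -
  interpret pair_graph G by fact
  have "\<exists>p. vwalk p (with_proj G) \<and> hd p = a \<and> last p = c \<and> set p \<subseteq> A"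
    using assms(1-3)
  proof (induction rule: converse_rtrancl_induct)
    case base
    then show ?case by (intro exI[of _ "[c]"]) auto
  next
    case (step a b)
    then have "b \<in> pverts G" "b \<in> A" "(a, b) \<in> parcs G" by (auto dest: wellformed')
    with step obtain p where p: "vwalk p (with_proj G)" "hd p = b" "last p = c" "set p \<subseteq> A"
      by auto
    then have "p \<noteq> []" by auto
    with p step.prems \<open>(a, b) \<in> parcs G\<close> show ?case
      by (intro exI[of _ "a # p"]) (auto intro: vwalk_consI)
  qed
  then obtain p where p: "vwalk p (with_proj G)" "hd p = a" "last p = c" "set p \<subseteq> A" by auto
  show thesis
    by (rule that[of "vwalk_to_vpath p"])
      (use p in \<open>auto simp: vwalk_to_vpath_hd vwalk_to_vpath_last dest: vwalk_to_vpath_subset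
        intro: vwalk_to_vpath_vpath\<close>)
qed

lemma joined_imp_vpath:
  assumes "joined G m a c" "a \<in> pverts G" "a \<noteq> m" "pair_graph G"
  obtains p where "vpath p (with_proj G)" "hd p = a" "last p = c" "m \<notin> set p"
proof -
  obtain p where "vpath p (with_proj G)" "hd p = a" "last p = c" "set p \<subseteq> - {m}"
    using rtrancl_imp_vpath[of a c G "-{m}"] assms unfolding joined_def by auto
  then show thesis using that by blast
qed

lemma vwalk_imp_joined:
  assumes "vwalk p (with_proj G)" "m \<notin> set p"
  shows "joined G m (hd p) (last p)"
  unfolding joined_def
  by (rule rtrancl_mono[THEN subsetD, OF _ vwalk_imp_rtrancl[OF assms(1)]]) (use assms(2) in auto)

lemma pawalk_of_vwalk:
  assumes "p \<noteq> []"
  shows "pcas (hd p) (vwalk_arcs p) (last p)" "pawalk_verts (hd p) (vwalk_arcs p) = p"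
  using assms by (induction p rule: vwalk_arcs.induct) auto

text \<open>
  Two neighbours of \<open>m\<close> that are joined by a path avoiding \<open>m\<close> lie on a cycle through \<open>m\<close>.
\<close>

lemma tree_graph_if_undirected_tree:
  assumes "undirected_tree T"
  shows "tree_graph T"
proof -
  interpret pair_graph T using assms by (simp add: undirected_tree_def)
  show ?thesis
  proof unfold_locales
    fix a c assume ac: "a \<in> pverts T" "c \<in> pverts T"
    have "strongly_connected (with_proj T)"
      using assms by (intro symmetric_connected_imp_strongly_connected)
        (auto simp: undirected_tree_def pair_sym_arcs)
    then have "a \<rightarrow>\<^sup>*\<^bsub>with_proj T\<^esub> c"
      using ac by (auto simp: strongly_connected_def)
    then show "(a, c) \<in> (parcs T)\<^sup>*"
      using reachable_rtranclI by fastforce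
  next
    fix m x y assume mx: "(m, x) \<in> parcs T" and my: "(m, y) \<in> parcs T" and "x \<noteq> y"
    show "\<not> joined T m x y"
    proof
      assume "joined T m x y"
      then obtain q where q: "vpath q (with_proj T)" "hd q = x" "last q = y" "m \<notin> set q"
        using mx by (elim joined_imp_vpath) (auto dest: wellformed' no_loops)
      have nm: "x \<noteq> m" "q \<noteq> []" using mx q by (auto dest: no_loops)
      \<comment> \<open>Going through \<open>m\<close> closes the path \<open>q\<close> to a cycle.\<close>
      let ?p = "vwalk_arcs (m # q @ [m])"
      have walk: "vwalk (m # q @ [m]) (with_proj T)"
      proof (rule vwalkI)
        show "set (m # q @ [m]) \<subseteq> verts (with_proj T)"
          using q mx unfolding vpath_def vwalk_def by (auto dest: wellformed')
        have "set ?p = insert (m, x) (insert (y, m) (set (vwalk_arcs q)))"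
          using nm q by (auto simp: vwalk_arcs_append)
        then show "set ?p \<subseteq> arcs_ends (with_proj T)"
          using q mx my unfolding vpath_def vwalk_def by (auto intro: arcs_symmetric)
      qed auto
      have len: "length ?p = length q + 1"
        using vwalk_length_simp[of "m # q @ [m]"] unfolding vwalk_length_def by simp
      have "length q \<noteq> 1" using q \<open>x \<noteq> y\<close> by (auto simp: length_Suc_conv)
      with nm have "3 \<le> length ?p" unfolding len by (cases q) (auto simp: Suc_le_eq)
      moreover have "cycle ?p"
        unfolding cycle_def
      proof (intro exI conjI)
        show "awalk m ?p m"
          using walk pawalk_of_vwalk(1)[of "m # q @ [m]"] mx
          by (auto simp: awalk_def vwalk_def simp del: vwalk_arcs_Cons)
        show "distinct (tl (pawalk_verts m ?p))"
          using pawalk_of_vwalk(2)[of "m # q @ [m]"] q by auto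
        show "?p \<noteq> []" by simp
      qed
      ultimately show False
        using assms by (auto simp: undirected_tree_def)
    qed
  qed
qed

subsection \<open>The separation relation\<close>

context tree_graph
begin

lemma joined_refl: "joined T m a a"
  by (simp add: joined_def)

lemma joined_sym: "joined T m a c \<Longrightarrow> joined T m c a"
proof -
  have "sym (parcs T \<inter> (- {m}) \<times> (- {m}))"
    by (auto intro!: symI arcs_symmetric)
  then show "joined T m a c \<Longrightarrow> joined T m c a"
    unfolding joined_def by (metis sym_rtrancl symD)
qed

lemma joined_trans: "joined T m a b \<Longrightarrow> joined T m b c \<Longrightarrow> joined T m a c"
  by (auto simp: joined_def)

lemma joined_arc: "(a, b) \<in> parcs T \<Longrightarrow> a \<noteq> m \<Longrightarrow> b \<noteq> m \<Longrightarrow> joined T m a b"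
  by (auto simp: joined_def)

lemma not_joined_self: "a \<noteq> m \<Longrightarrow> \<not> joined T m a m"
  unfolding joined_def by (auto elim: rtranclE)

lemma in_beyond_iff: "x \<in> beyond T v s \<longleftrightarrow> x \<in> pverts T \<and> \<not> joined T s v x"
  by (simp add: beyond_def)

lemma self_in_beyond: "s \<in> pverts T \<Longrightarrow> s \<noteq> v \<Longrightarrow> s \<in> beyond T v s"
  using not_joined_self by (auto simp: in_beyond_iff)

lemma root_notin_beyond: "v \<notin> beyond T v s"
  by (auto simp: in_beyond_iff joined_refl)

lemma finite_beyond: "finite (beyond T v s)"
  using pair_finite_verts by (auto simp: beyond_def)

text \<open>
  Follow a walk from \<open>a\<close>: whichever of \<open>b\<close> and \<open>c\<close> is met first is reached without passing the
  other one.  This does the work of comparing positions on a path.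
\<close>

lemma joined_or_joined:
  assumes "a \<in> pverts T" "b \<in> pverts T" "a \<noteq> b" "a \<noteq> c" "b \<noteq> c"
  shows "joined T b a c \<or> joined T c a b"
proof -
  have "(x \<noteq> b \<and> x \<noteq> c \<and> joined T b a x \<and> joined T c a x) \<or> joined T b a c \<or> joined T c a b"
    if "(a, x) \<in> (parcs T)\<^sup>*" for x
    using that
  proof induction
    case base
    then show ?case using assms by (simp add: joined_refl)
  next
    case (step x y)
    then show ?case
      using assms(5) by (metis joined_arc joined_trans)
  qed
  from this[OF linked[OF assms(1,2)]] show ?thesis by auto
qed

text \<open>
  Stop the walk just before its first visit of \<open>v\<close>.  If \<open>A\<close> is the complement of another vertex, the
  walk enters \<open>v\<close> from elsewhere.
\<close>

lemma last_step_before: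
  assumes "(a, v) \<in> (parcs T \<inter> A \<times> A)\<^sup>*" "a \<noteq> v"
  shows "\<exists>x \<in> A. (v, x) \<in> parcs T \<and> joined T v a x"
  using assms
proof (induction rule: converse_rtrancl_induct)
  case (step a b)
  show ?case
  proof (cases "b = v")
    case True
    with step show ?thesis by (auto intro: arcs_symmetric joined_refl)
  next
    case False
    then show ?thesis
      using step joined_trans[OF joined_arc[of a b v]] by blast
  qed
qed simp

lemma ex_nbr_toward:
  assumes "v \<in> pverts T" "a \<in> pverts T" "a \<noteq> v"
  obtains x where "(v, x) \<in> parcs T" "joined T v x a"
proof -
  have "(a, v) \<in> (parcs T \<inter> UNIV \<times> UNIV)\<^sup>*" using linked assms by simp
  from last_step_before[OF this assms(3)] show thesis using that joined_sym by blast
qed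

text \<open>
  A walk from \<open>y\<close> to \<open>v\<close> that avoids \<open>x\<close> enters \<open>v\<close> through another neighbour, and that neighbour
  is separated from \<open>x\<close> by \<open>v\<close>.
\<close>

lemma in_beyond_nbr_iff:
  assumes "(v, x) \<in> parcs T" "y \<in> pverts T" "y \<noteq> v"
  shows "y \<in> beyond T v x \<longleftrightarrow> joined T v x y"
proof
  have vx: "v \<in> pverts T" "x \<in> pverts T" "x \<noteq> v"
    using assms(1) by (auto dest: wellformed' no_loops)
  show "joined T v x y" if "y \<in> beyond T v x"
  proof (cases "y = x")
    case False
    have "joined T v y x \<or> joined T x y v"
      using joined_or_joined[of y v x] False vx assms by auto
    then show ?thesis using that joined_sym by (auto simp: in_beyond_iff)
  qed (simp add: joined_refl)
  show "y \<in> beyond T v x" if j: "joined T v x y"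
  proof (rule ccontr)
    assume "y \<notin> beyond T v x"
    then have "joined T x y v" using assms joined_sym by (auto simp: in_beyond_iff)
    then obtain x' where "x' \<in> - {x}" "(v, x') \<in> parcs T" "joined T v y x'"
      using last_step_before[of y v "- {x}"] assms(3) unfolding joined_def by auto
    then show False
      using separates[OF assms(1), of x'] joined_trans[OF j] by auto
  qed
qed

lemma ex_branch:
  assumes "v \<in> pverts T" "a \<in> pverts T" "a \<noteq> v"
  obtains x where "(v, x) \<in> parcs T" "a \<in> beyond T v x"
  using ex_nbr_toward[OF assms] in_beyond_nbr_iff assms by metis

lemma branches_disjoint:
  assumes "(v, x) \<in> parcs T" "(v, y) \<in> parcs T" "x \<noteq> y"
  shows "beyond T v x \<inter> beyond T v y = {}"
proof -
  have False if "z \<in> beyond T v x" "z \<in> beyond T v y" for z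
  proof -
    have "z \<in> pverts T" "z \<noteq> v" using that by (auto simp: in_beyond_iff joined_refl)
    then have "joined T v x z" "joined T v y z" using that in_beyond_nbr_iff assms by auto
    then show False using separates[OF assms] joined_trans joined_sym by blast
  qed
  then show ?thesis by auto
qed

text \<open>
  From a common element one of \<open>s\<close> and \<open>s'\<close> is reached without passing the other one, and from
  there \<open>v\<close> is reached, still without passing it.
\<close>

lemma beyond_disjoint:
  assumes "s \<in> pverts T" "s' \<in> pverts T" "s \<noteq> s'" "joined T s v s'" "joined T s' v s"
  shows "beyond T v s \<inter> beyond T v s' = {}"
proof -
  have False if x: "x \<in> beyond T v s" "x \<in> beyond T v s'" for x
  proof -
    have "x \<noteq> s" "x \<noteq> s'" using x assms by (auto simp: in_beyond_iff)
    then have "joined T s x s' \<or> joined T s' x s"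
      using joined_or_joined[of x s s'] x assms by (auto simp: in_beyond_iff)
    then show False
      using x assms joined_trans joined_sym unfolding in_beyond_iff by blast
  qed
  then show ?thesis by auto
qed

lemma joined_above:
  assumes "v \<in> pverts T" "s \<noteq> v" "y \<in> beyond T v s" "y \<noteq> s"
  shows "joined T y v s"
  using joined_or_joined[of v y s] assms root_notin_beyond[of v s] by (auto simp: in_beyond_iff)

lemma beyond_trans:
  assumes "v \<in> pverts T" "s \<in> pverts T" "s \<noteq> v" "y \<in> beyond T v s"
  shows "beyond T v y \<subseteq> beyond T v s"
proof (cases "y = s")
  case False
  show ?thesis
  proof
    fix x assume x: "x \<in> beyond T v y"
    show "x \<in> beyond T v s"
    proof (rule ccontr)
      assume "x \<notin> beyond T v s"
      then have sx: "joined T s v x" using x by (auto simp: in_beyond_iff)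
      have "x \<noteq> s" using sx not_joined_self assms(3) by metis
      moreover have "x \<noteq> y" using sx assms(4) by (auto simp: in_beyond_iff)
      ultimately have "joined T y x s \<or> joined T s x y"
        using joined_or_joined[of x y s] False x assms by (auto simp: in_beyond_iff)
      moreover have "joined T y v s" using joined_above assms False by blast
      ultimately show False
        using x sx assms(4) joined_trans joined_sym unfolding in_beyond_iff by blast
    qed
  qed
qed simp

lemma beyond_psubset:
  assumes "v \<in> pverts T" "s \<in> pverts T" "s \<noteq> v" "y \<in> beyond T v s" "y \<noteq> s"
  shows "beyond T v y \<subset> beyond T v s"
proof -
  have "s \<notin> beyond T v y" using joined_above[of v s y] assms by (auto simp: in_beyond_iff)
  moreover have "s \<in> beyond T v s" using self_in_beyond assms by auto
  ultimately show ?thesis using beyond_trans[of v s y] assms by blast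
qed

subsection \<open>Children\<close>

lemma nbrs_finite: "finite (nbrs T v)"
proof -
  have "nbrs T v \<subseteq> pverts T" by (auto simp: nbrs_def dest: wellformed')
  then show ?thesis using pair_finite_verts finite_subset by blast
qed

text \<open>
  Exactly one neighbour of \<open>s\<close> lies on the side of the root \<open>v\<close>; all others are children.
\<close>

lemma ex_parent:
  assumes "v \<in> pverts T" "s \<in> pverts T" "s \<noteq> v"
  obtains p where "p \<in> nbrs T s" "nbrs T s - {p} = nbrs T s \<inter> beyond T v s" "joined T s v p"
proof -
  obtain p where p: "(s, p) \<in> parcs T" "joined T s p v"
    using ex_nbr_toward[of s v] assms by blast
  have "y \<in> beyond T v s \<longleftrightarrow> y \<noteq> p" if y: "(s, y) \<in> parcs T" for y
  proof
    assume "y \<noteq> p"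
    then show "y \<in> beyond T v s"
      using separates[OF p(1) y] p(2) y joined_trans by (auto simp: in_beyond_iff dest: wellformed')
  qed (use p joined_sym in \<open>auto simp: in_beyond_iff\<close>)
  then have "nbrs T s - {p} = nbrs T s \<inter> beyond T v s"
    by (auto simp: nbrs_def)
  then show thesis using that[of p] p joined_sym by (auto simp: nbrs_def)
qed

lemma child_props:
  assumes "v \<in> pverts T" "s \<in> pverts T" "s \<noteq> v" "y \<in> nbrs T s" "y \<in> beyond T v s"
  shows "y \<noteq> s" "joined T y v s" "beyond T v y = beyond T s y"
proof -
  show "y \<noteq> s" using assms(4) no_loops' by (auto simp: nbrs_def)
  then show "joined T y v s" using joined_above assms by blast
  then show "beyond T v y = beyond T s y"
    using joined_trans joined_sym unfolding beyond_def by blast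
qed

lemma ex_child_toward:
  assumes "v \<in> pverts T" "s \<in> pverts T" "s \<noteq> v" "z \<in> beyond T v s" "z \<noteq> s"
  obtains y where "y \<in> nbrs T s" "y \<in> beyond T v s" "z \<in> beyond T v y"
proof -
  have z: "z \<in> pverts T" using assms(4) by (auto simp: in_beyond_iff)
  obtain y where y: "(s, y) \<in> parcs T" "joined T s y z"
    using ex_nbr_toward[of s z] assms z by blast
  have "z \<in> beyond T s y" using in_beyond_nbr_iff y z assms by blast
  moreover have yb: "y \<in> beyond T v s"
    using y assms(4) joined_trans by (auto simp: in_beyond_iff dest: wellformed')
  ultimately show thesis
    using that[of y] child_props[of v s y] assms y by (auto simp: nbrs_def)
qed

lemma siblings_disjoint:
  assumes "v \<in> pverts T" "s \<in> pverts T" "s \<noteq> v"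
    "y \<in> nbrs T s" "y \<in> beyond T v s" "y' \<in> nbrs T s" "y' \<in> beyond T v s" "y \<noteq> y'"
  shows "beyond T v y \<inter> beyond T v y' = {}"
  using branches_disjoint[of s y y'] child_props(3)[of v s y] child_props(3)[of v s y'] assms
  by (auto simp: nbrs_def)

subsection \<open>Leaves\<close>

text \<open>
  Descending from \<open>s\<close> to a child as long as there is one ends in a leaf.
\<close>

lemma leaf_beyond:
  assumes "v \<in> pverts T" "s \<in> pverts T" "s \<noteq> v"
  shows "\<exists>f \<in> leaves T. f \<in> beyond T v s"
  using assms(2,3)
proof (induction "card (beyond T v s)" arbitrary: s rule: less_induct)
  case less
  obtain p where p: "p \<in> nbrs T s" "nbrs T s - {p} = nbrs T s \<inter> beyond T v s"
    using ex_parent[of v s] assms less.prems by blast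
  show ?case
  proof (cases "nbrs T s = {p}")
    case True
    then have "s \<in> leaves T" using less.prems by (simp add: leaves_def deg_eq_card_nbrs)
    then show ?thesis using self_in_beyond less.prems by blast
  next
    case False
    then obtain y where y: "y \<in> nbrs T s" "y \<in> beyond T v s" using p by blast
    have ys: "y \<noteq> s" "y \<in> pverts T" "y \<noteq> v"
      using y child_props(1)[of v s y] assms less.prems by (auto simp: in_beyond_iff joined_refl)
    have sub: "beyond T v y \<subset> beyond T v s"
      using beyond_psubset[of v s y] y ys assms less.prems by blast
    then have "card (beyond T v y) < card (beyond T v s)"
      using finite_beyond psubset_card_mono by blast
    from less.hyps[OF this] ys sub show ?thesis by blast
  qed
qed

text \<open>
  A vertex of degree at least 3 has two children, and there is a leaf behind each of them.
\<close>

lemma two_leaves_beyond_branch_vertex: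
  assumes "v \<in> pverts T" "s \<in> pverts T" "s \<noteq> v" "3 \<le> deg T s"
  shows "2 \<le> card (leaves T \<inter> beyond T v s)"
proof -
  obtain p where p: "p \<in> nbrs T s" "nbrs T s - {p} = nbrs T s \<inter> beyond T v s"
    using ex_parent[of v s] assms by blast
  have "2 \<le> card (nbrs T s - {p})"
    using assms(4) p(1) by (simp add: deg_eq_card_nbrs)
  then obtain y y' where "y \<in> nbrs T s - {p}" "y' \<in> nbrs T s - {p}" "y \<noteq> y'"
    by (auto simp: numeral_2_eq_2 card_le_Suc_iff)
  then have y: "y \<in> nbrs T s" "y \<in> beyond T v s" "y' \<in> nbrs T s" "y' \<in> beyond T v s" "y \<noteq> y'"
    unfolding p(2) by auto
  have "y \<in> pverts T" "y \<noteq> v" "y' \<in> pverts T" "y' \<noteq> v"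
    using y by (auto simp: in_beyond_iff joined_refl)
  then obtain f g where fg: "f \<in> leaves T" "f \<in> beyond T v y" "g \<in> leaves T" "g \<in> beyond T v y'"
    using leaf_beyond assms(1) by metis
  then have "f \<noteq> g" using siblings_disjoint[of v s y y'] assms y by blast
  moreover have "{f, g} \<subseteq> leaves T \<inter> beyond T v s"
    using fg beyond_trans[of v s y] beyond_trans[of v s y'] assms y by blast
  ultimately show ?thesis
    using card_mono[of "leaves T \<inter> beyond T v s" "{f, g}"] finite_beyond by auto
qed

text \<open>
  For nonempty \<open>F\<close> this is the lowest common ancestor in the tree rooted at \<open>v\<close>.
\<close>

lemma ex_lowest:
  assumes "v \<in> pverts T" "s \<in> pverts T" "s \<noteq> v" "F \<subseteq> beyond T v s"
  obtains x where "x \<in> beyond T v s" "F \<subseteq> beyond T v x"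
    "\<And>y. y \<in> nbrs T x \<Longrightarrow> y \<in> beyond T v x \<Longrightarrow> \<not> F \<subseteq> beyond T v y"
proof -
  let ?P = "\<lambda>x. x \<in> beyond T v s \<and> F \<subseteq> beyond T v x"
  obtain x where x: "?P x" and min: "\<And>y. ?P y \<Longrightarrow> card (beyond T v x) \<le> card (beyond T v y)"
    using ex_has_least_nat[of ?P s "\<lambda>x. card (beyond T v x)"] self_in_beyond assms by blast
  have xv: "x \<in> pverts T" "x \<noteq> v" using x by (auto simp: in_beyond_iff joined_refl)
  show thesis
  proof (rule that[of x])
    fix y assume y: "y \<in> nbrs T x" "y \<in> beyond T v x"
    then have "beyond T v y \<subset> beyond T v x"
      using beyond_psubset[of v x y] child_props(1)[of v x y] assms(1) xv by blast
    then have "card (beyond T v y) < card (beyond T v x)"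
      using finite_beyond psubset_card_mono by blast
    moreover have "y \<in> beyond T v s" using y beyond_trans[of v s x] x assms by blast
    ultimately show "\<not> F \<subseteq> beyond T v y" using min[of y] by auto
  qed (use x in auto)
qed

text \<open>
  The lowest common ancestor of the two leaves has two children and a parent.
\<close>

lemma branch_vertex_above_two_leaves:
  assumes "v \<in> pverts T" "s \<in> pverts T" "s \<noteq> v"
    and fg: "f \<in> leaves T" "g \<in> leaves T" "f \<noteq> g" "f \<in> beyond T v s" "g \<in> beyond T v s"
  obtains x where "x \<in> beyond T v s" "3 \<le> deg T x"
proof -
  obtain x where x: "x \<in> beyond T v s" "{f, g} \<subseteq> beyond T v x"
    and low: "\<And>y. y \<in> nbrs T x \<Longrightarrow> y \<in> beyond T v x \<Longrightarrow> \<not> {f, g} \<subseteq> beyond T v y"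
    using ex_lowest[of v s "{f, g}"] assms by blast
  have xv: "x \<in> pverts T" "x \<noteq> v" using x by (auto simp: in_beyond_iff joined_refl)
  obtain p where p: "p \<in> nbrs T x" "joined T x v p"
    using ex_parent[of v x] assms(1) xv by blast
  have notp: "y \<noteq> p" if "y \<in> beyond T v x" for y using p that by (auto simp: in_beyond_iff)
  have noleaf: "h \<noteq> x" if h: "h \<in> leaves T" "h' \<in> {f, g}" "h' \<noteq> h" for h h'
  proof
    assume "h = x"
    then obtain y where "y \<in> nbrs T x" "y \<in> beyond T v x"
      using ex_child_toward[of v x h'] x(2) h assms(1) xv by blast
    then have "y \<noteq> p" "card {y, p} \<le> deg T x"
      unfolding deg_eq_card_nbrs using p nbrs_finite notp by (blast, intro card_mono) auto
    then show False using h \<open>h = x\<close> by (simp add: leaves_def)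
  qed
  have "f \<noteq> x" "g \<noteq> x" using noleaf[of f g] noleaf[of g f] fg by auto
  then obtain y y' where y: "y \<in> nbrs T x" "y \<in> beyond T v x" "f \<in> beyond T v y"
      "y' \<in> nbrs T x" "y' \<in> beyond T v x" "g \<in> beyond T v y'"
    using ex_child_toward[of v x f] ex_child_toward[of v x g] x assms(1) xv by (metis insert_subset)
  then have "y \<noteq> y'" using low by auto
  then have "card {y, y', p} = 3" using notp y by auto
  moreover have "card {y, y', p} \<le> deg T x"
    unfolding deg_eq_card_nbrs using y p nbrs_finite by (intro card_mono) auto
  ultimately show thesis using that x by auto
qed

lemma sum_leaves_of_branches:
  assumes "v \<in> pverts T"
  shows "(\<Sum>x\<in>nbrs T v. card (leaves T \<inter> beyond T v x)) = card (leaves T - {v})"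
proof -
  have "(\<Sum>x\<in>nbrs T v. card (leaves T \<inter> beyond T v x)) = card (\<Union>x\<in>nbrs T v. leaves T \<inter> beyond T v x)"
    using branches_disjoint by (intro card_UN_disjoint[symmetric] nbrs_finite)
      (auto intro: finite_beyond finite_Int simp: nbrs_def)
  also have "(\<Union>x\<in>nbrs T v. leaves T \<inter> beyond T v x) = leaves T - {v}"
  proof (intro equalityI subsetI)
    fix f assume f: "f \<in> leaves T - {v}"
    then obtain x where "(v, x) \<in> parcs T" "f \<in> beyond T v x"
      using ex_branch[OF assms, of f] by (auto simp: leaves_def)
    with f show "f \<in> (\<Union>x\<in>nbrs T v. leaves T \<inter> beyond T v x)" by (auto simp: nbrs_def)
  qed (auto simp: root_notin_beyond)
  finally show ?thesis .
qed

lemma finite_leaves: "finite (leaves T)"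
  using pair_finite_verts by (auto simp: leaves_def)

text \<open>
  Having only one neighbour, a leaf lies between no two vertices.
\<close>

lemma joined_leaf:
  assumes "f \<in> leaves T" "a \<in> pverts T" "c \<in> pverts T" "a \<noteq> f" "c \<noteq> f"
  shows "joined T f a c"
proof -
  have f: "f \<in> pverts T" "card (nbrs T f) = 1"
    using assms by (auto simp: leaves_def deg_eq_card_nbrs)
  obtain x where x: "(f, x) \<in> parcs T" "joined T f x a" using ex_nbr_toward[of f a] f assms by blast
  obtain y where y: "(f, y) \<in> parcs T" "joined T f y c" using ex_nbr_toward[of f c] f assms by blast
  have "x = y" using x(1) y(1) f(2)
    by (metis card_1_singletonE mem_Collect_eq nbrs_def singletonD)
  then show ?thesis using x y joined_trans joined_sym by blast
qed

subsection \<open>Paths\<close>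

text \<open>
  The two neighbours of \<open>x\<close> on the path are separated by \<open>x\<close>, so its two ends are as well.
\<close>

lemma interior_separates:
  assumes "vpath (p @ x # q) (with_proj T)" "p \<noteq> []" "q \<noteq> []"
  shows "\<not> joined T x (hd p) (last q)"
proof
  assume j: "joined T x (hd p) (last q)"
  have w: "vwalk (p @ x # q) (with_proj T)" and d: "distinct (p @ x # q)"
    using assms unfolding vpath_def by auto
  have "vwalk p (with_proj T)" using vwalkI_append_l[OF assms(2) w] .
  then have 1: "joined T x (hd p) (last p)" using vwalk_imp_joined d by fastforce
  have w2: "vwalk (x # q) (with_proj T)" using vwalkI_append_r[OF _ w] by simp
  then have "vwalk q (with_proj T)" "(x, hd q) \<in> parcs T"
    using assms(3) by (auto elim: vwalk_consE)
  then have 2: "joined T x (hd q) (last q)" using vwalk_imp_joined d by fastforce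
  have "(last p, x) \<in> set (vwalk_arcs (p @ x # q))"
    using assms by (simp add: vwalk_arcs_append)
  then have "(x, last p) \<in> parcs T" using w arcs_symmetric by (auto simp: vwalk_def)
  moreover have "last p \<noteq> hd q"
  proof -
    have "last p \<in> set p" "hd q \<in> set q" using assms(2,3) by simp_all
    then show ?thesis using d by auto
  qed
  moreover have "joined T x (last p) (hd q)" using 1 2 j joined_trans joined_sym by blast
  ultimately show False using separates \<open>(x, hd q) \<in> parcs T\<close> by blast
qed

lemma ex_vpath:
  assumes "a \<in> pverts T" "c \<in> pverts T"
  obtains p where "vpath p (with_proj T)" "hd p = a" "last p = c"
  using rtrancl_imp_vpath[of a c T UNIV] linked assms pair_graph by auto

lemma ex_shortest_path:
  assumes "a \<in> pverts T" "c \<in> pverts T"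
  obtains p where "shortest_path T p" "hd p = a" "last p = c"
proof -
  let ?P = "\<lambda>p. vpath p (with_proj T) \<and> hd p = a \<and> last p = c"
  obtain p where "?P p" "\<And>q. ?P q \<Longrightarrow> vwalk_length p \<le> vwalk_length q"
    using ex_has_least_nat[of ?P _ vwalk_length] ex_vpath[OF assms] by metis
  then show thesis using that by (auto simp: shortest_path_def)
qed

lemma split_three:
  assumes "3 \<le> card (set p \<inter> S)"
  obtains a b c p1 p2 p3 p4 where "p = p1 @ a # p2 @ b # p3 @ c # p4" "a \<in> S" "b \<in> S" "c \<in> S"
proof -
  have ne: "\<exists>q. filter (\<lambda>x. x \<in> S) p = q \<and> 3 \<le> length q"
    using assms card_length[of "filter (\<lambda>x. x \<in> S) p"] by (auto simp: Int_def)
  then obtain a b c r where "filter (\<lambda>x. x \<in> S) p = a # b # c # r"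
    by (auto simp: numeral_3_eq_3 Suc_le_length_iff)
  then obtain us vs where 1: "p = us @ a # vs" "a \<in> S" "b # c # r = filter (\<lambda>x. x \<in> S) vs"
    by (auto dest: filter_eq_ConsD)
  from 1(3)[symmetric] obtain us' vs' where
    2: "vs = us' @ b # vs'" "b \<in> S" "c # r = filter (\<lambda>x. x \<in> S) vs'"
    by (auto dest: filter_eq_ConsD)
  from 2(3)[symmetric] obtain us'' vs'' where "vs' = us'' @ c # vs''" "c \<in> S"
    by (auto dest: filter_eq_ConsD)
  with 1 2 show thesis using that by auto
qed

text \<open>
  If \<open>b\<close> separates \<open>a\<close> from \<open>c\<close>, every path from \<open>a\<close> to \<open>c\<close> contains \<open>b\<close>, in particular a shortest
  one.  If a path contains three members, the middle one separates the other two.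
\<close>

lemma general_position_iff:
  "general_position T S \<longleftrightarrow> S \<subseteq> pverts T \<and>
    (\<forall>a\<in>S. \<forall>b\<in>S. \<forall>c\<in>S. a \<noteq> b \<longrightarrow> b \<noteq> c \<longrightarrow> a \<noteq> c \<longrightarrow> joined T b a c)"
    (is "_ \<longleftrightarrow> _ \<and> ?J")
proof (intro iffI conjI ballI impI; (elim conjE)?)
  fix a b c assume gp: "general_position T S" and abc: "a \<in> S" "b \<in> S" "c \<in> S" "a \<noteq> b" "b \<noteq> c" "a \<noteq> c"
  then have V: "a \<in> pverts T" "c \<in> pverts T" by (auto simp: general_position_def)
  show "joined T b a c"
  proof (rule ccontr)
    assume n: "\<not> joined T b a c"
    obtain p where p: "shortest_path T p" "hd p = a" "last p = c" using ex_shortest_path[OF V] .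
    then have w: "vwalk p (with_proj T)" by (auto simp: shortest_path_def)
    then have "p \<noteq> []" by auto
    then have "{a, b, c} \<subseteq> set p \<inter> S" using vwalk_imp_joined[OF w, of b] n p abc by auto
    then have "card {a, b, c} \<le> card (set p \<inter> S)" by (intro card_mono) auto
    also have "\<dots> \<le> 2" using gp p by (auto simp: general_position_def)
    finally show False using abc by auto
  qed
next
  assume "general_position T S" then show "S \<subseteq> pverts T" by (auto simp: general_position_def)
next
  assume S: "S \<subseteq> pverts T" and J: ?J
  have "card (set p \<inter> S) \<le> 2" if p: "shortest_path T p" for p
  proof (rule ccontr)
    assume "\<not> ?thesis"
    then obtain a b c p1 p2 p3 p4 where
      pe: "p = p1 @ a # p2 @ b # p3 @ c # p4" and abc: "a \<in> S" "b \<in> S" "c \<in> S"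
      using split_three[of p S] by (metis not_less_eq_eq numeral_3_eq_3 numeral_2_eq_2)
    have vp: "vpath p (with_proj T)" using p by (auto simp: shortest_path_def)
    then have "vwalk (p1 @ (a # p2 @ b # p3 @ [c]) @ p4) (with_proj T)" using pe by auto
    then have "vwalk (a # p2 @ b # p3 @ [c]) (with_proj T)"
        using vwalkI_append_l[OF _ vwalkI_append_r[of "(a # p2 @ b # p3 @ [c]) @ p4" p1]] by simp
    moreover have "distinct ((a # p2) @ b # (p3 @ [c]))" using vp pe by (auto simp: vpath_def)
    ultimately have "vpath ((a # p2) @ b # (p3 @ [c])) (with_proj T)" by (simp add: vpath_def)
    from interior_separates[OF this] have "\<not> joined T b a c" by simp
    then show False using J abc vp pe by auto
  qed
  then show "general_position T S" using S by (auto simp: general_position_def)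
qed

end

section \<open>Reduction of the game to maximal sets in general position\<close>

lemma general_position_card_le_2:
  assumes "S \<subseteq> pverts G" "finite S" "card S \<le> 2"
  shows "general_position G S"
proof -
  have "card (set p \<inter> S) \<le> 2" for p
    using card_mono[OF assms(2), of "set p \<inter> S"] assms(3) by simp
  then show ?thesis using assms(1) by (simp add: general_position_def)
qed

lemma legal_moves_empty: "legal_moves G {} = pverts G"
  by (auto simp: legal_moves_def intro!: general_position_card_le_2)

lemma legal_moves_singleton:
  assumes "v \<in> pverts G"
  shows "legal_moves G {v} = pverts G - {v}"
  using assms by (auto simp: legal_moves_def card_insert_if intro!: general_position_card_le_2)

definition maximal_general_position :: "'a pair_pre_digraph \<Rightarrow> 'a set \<Rightarrow> bool" where
  "maximal_general_position G M \<longleftrightarrow> general_position G M \<and> legal_moves G M = {}"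

text \<open>
  Every play ends in a maximal set.  Beyond the first three moves this is all that is used about
  optimal play: bounds on all such sets, or on all sets in general position, bound the value.
\<close>

lemma game_value_attained:
  assumes "finite (pverts G)" "general_position G S"
  shows "\<exists>M. S \<subseteq> M \<and> maximal_general_position G M \<and> card M = game_value G P S"
  using assms
proof (induction G P S rule: game_value.induct)
  case (1 G P S)
  show ?case
  proof (cases "legal_moves G S = {}")
    case True
    with 1 show ?thesis
      by (intro exI[of _ S]) (simp add: game_value.simps[of G P S] maximal_general_position_def)
  next
    case False
    let ?f = "\<lambda>v. game_value G (opponent P) (insert v S)"
    have "finite (legal_moves G S)"
      using 1 by (auto simp: legal_moves_def)
    then have "game_value G P S \<in> ?f ` legal_moves G S"
      using 1 False Max_in[of "?f ` legal_moves G S"] Min_in[of "?f ` legal_moves G S"]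
      by (cases P) (simp_all add: game_value.simps[of G _ S])
    then obtain v where v: "v \<in> legal_moves G S" "game_value G P S = ?f v" by auto
    then have "general_position G (insert v S)" by (simp add: legal_moves_def)
    with 1 False v obtain M where "insert v S \<subseteq> M" "maximal_general_position G M" "card M = ?f v"
      by blast
    with v show ?thesis by auto
  qed
qed

lemma finite_legal_moves: "finite (pverts G) \<Longrightarrow> finite (legal_moves G S)"
  by (auto simp: legal_moves_def)

lemma game_value_Blocker_eq:
  assumes "finite (pverts G)" "legal_moves G S \<noteq> {}"
  shows "game_value G Blocker S = Min ((\<lambda>v. game_value G Builder (insert v S)) ` legal_moves G S)"
  using assms by (subst game_value.simps) simp

lemma game_value_Builder_eq:
  assumes "finite (pverts G)" "legal_moves G S \<noteq> {}"
  shows "game_value G Builder S = Max ((\<lambda>v. game_value G Blocker (insert v S)) ` legal_moves G S)"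
  using assms by (subst game_value.simps) simp

lemma game_value_Blocker_le:
  assumes "finite (pverts G)" "v \<in> legal_moves G S"
  shows "game_value G Blocker S \<le> game_value G Builder (insert v S)"
  using assms game_value_Blocker_eq[of G S] finite_legal_moves[of G S] by fastforce

lemma game_value_Builder_ge:
  assumes "finite (pverts G)" "v \<in> legal_moves G S"
  shows "game_value G Blocker (insert v S) \<le> game_value G Builder S"
  using assms game_value_Builder_eq[of G S] finite_legal_moves[of G S] by fastforce

lemma game_value_Blocker_attained:
  assumes "finite (pverts G)" "legal_moves G S \<noteq> {}"
  obtains v where "v \<in> legal_moves G S" "game_value G Blocker S = game_value G Builder (insert v S)"
proof -
  let ?A = "(\<lambda>v. game_value G Builder (insert v S)) ` legal_moves G S"
  have "Min ?A \<in> ?A" using assms by (intro Min_in) (auto simp: finite_legal_moves)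
  then show thesis using that game_value_Blocker_eq[OF assms] by auto
qed

lemma game_value_Builder_attained:
  assumes "finite (pverts G)" "legal_moves G S \<noteq> {}"
  obtains v where "v \<in> legal_moves G S" "game_value G Builder S = game_value G Blocker (insert v S)"
proof -
  let ?A = "(\<lambda>v. game_value G Blocker (insert v S)) ` legal_moves G S"
  have "Max ?A \<in> ?A" using assms by (intro Max_in) (auto simp: finite_legal_moves)
  then show thesis using that game_value_Builder_eq[OF assms] by auto
qed

text \<open>
  It suffices that Builder has an answer to each opening after which the rest of the play does not
  matter.
\<close>

lemma gp_game'_lower_bound:
  assumes "finite (pverts G)" "pverts G \<noteq> {}"
    and reply: "\<And>v. v \<in> pverts G \<Longrightarrow> \<exists>u \<in> pverts G - {v}.
      \<forall>M. {v, u} \<subseteq> M \<longrightarrow> maximal_general_position G M \<longrightarrow> N \<le> card M"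
  shows "N \<le> gp_game' G"
proof -
  obtain v where v: "v \<in> pverts G" "gp_game' G = game_value G Builder {v}"
    using game_value_Blocker_attained[of G "{}"] assms
    by (auto simp: legal_moves_empty gp_game'_def)
  obtain u where u: "u \<in> pverts G - {v}"
      "\<forall>M. {v, u} \<subseteq> M \<longrightarrow> maximal_general_position G M \<longrightarrow> N \<le> card M"
    using reply[OF v(1)] by blast
  have "u \<in> legal_moves G {v}" using legal_moves_singleton[OF v(1)] u(1) by simp
  then have "game_value G Blocker {u, v} \<le> gp_game' G" "general_position G {u, v}"
    using game_value_Builder_ge[OF assms(1), of u "{v}"] unfolding v(2)
    by (blast, simp add: legal_moves_def)
  moreover obtain M where "{v, u} \<subseteq> M" "maximal_general_position G M"
      "card M = game_value G Blocker {u, v}"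
    using game_value_attained[OF assms(1) calculation(2), of Blocker] by blast
  ultimately show ?thesis using u(2) by fastforce
qed

text \<open>
  The consequences of a large value for one opening \<open>v\<close>: Builder has an answer \<open>u\<close> such that, no
  matter which \<open>w\<close> Blocker marks next, a set as large as the value still contains all three vertices.
\<close>

lemma builder_reply:
  assumes "finite (pverts G)" "v \<in> pverts G" "pverts G \<noteq> {v}"
  obtains u M where "u \<in> pverts G - {v}" "{v, u} \<subseteq> M" "general_position G M" "gp_game' G \<le> card M"
    "\<And>w. w \<notin> {v, u} \<Longrightarrow> general_position G {v, u, w} \<Longrightarrow>
      \<exists>M. {v, u, w} \<subseteq> M \<and> general_position G M \<and> gp_game' G \<le> card M"
proof -
  have first: "gp_game' G \<le> game_value G Builder {v}"
    using game_value_Blocker_le[of G v "{}"] assms by (simp add: gp_game'_def legal_moves_empty)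
  obtain u where u: "u \<in> pverts G - {v}" "game_value G Builder {v} = game_value G Blocker {v, u}"
    using game_value_Builder_attained[of G "{v}"] assms legal_moves_singleton[of v G]
    by (metis Diff_eq_empty_iff insert_commute subset_singletonD empty_iff)
  have gp: "general_position G {v, u}"
    using u assms by (intro general_position_card_le_2) (auto simp: card_insert_if)
  obtain M where "{v, u} \<subseteq> M" "maximal_general_position G M" "card M = game_value G Blocker {v, u}"
    using game_value_attained[OF assms(1) gp] by blast
  then show thesis
  proof (intro that[of u M])
    fix w assume w: "w \<notin> {v, u}" "general_position G {v, u, w}"
    then have "w \<in> legal_moves G {v, u}"
      by (auto simp: legal_moves_def general_position_def insert_commute)
    then have le: "game_value G Blocker {v, u} \<le> game_value G Builder {v, u, w}"
      using game_value_Blocker_le[OF assms(1)] by (metis insert_commute)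
    obtain M where "{v, u, w} \<subseteq> M" "maximal_general_position G M"
        "card M = game_value G Builder {v, u, w}"
      using game_value_attained[OF assms(1) w(2)] by blast
    then show "\<exists>M. {v, u, w} \<subseteq> M \<and> general_position G M \<and> gp_game' G \<le> card M"
      using le first u by (intro exI[of _ M]) (auto simp: maximal_general_position_def)
  qed (use first u in \<open>auto simp: maximal_general_position_def\<close>)
qed

section \<open>The size of the final set\<close>

context tree_graph
begin

lemma gp_joined:
  "general_position T S \<Longrightarrow> a \<in> S \<Longrightarrow> b \<in> S \<Longrightarrow> c \<in> S \<Longrightarrow> a \<noteq> b \<Longrightarrow> b \<noteq> c \<Longrightarrow> a \<noteq> c \<Longrightarrow> joined T b a c"
  unfolding general_position_iff by blast

text \<open>
  The vertices of \<open>M - {v}\<close> lie in the branch of \<open>u\<close>, since otherwise \<open>v\<close> would separate them from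
  \<open>u\<close>.  The sets behind them are disjoint and each of them takes up a leaf of the branch; a vertex
  with two leaves behind it wastes one.
\<close>

lemma card_general_position_le:
  assumes gp: "general_position T M" and uv: "v \<in> M" "u \<in> M" "u \<noteq> v"
    and x: "(v, x) \<in> parcs T" "u \<in> beyond T v x"
  shows "card M \<le> 1 + card (leaves T \<inter> beyond T v x)"
    and "s \<in> M \<Longrightarrow> s \<noteq> v \<Longrightarrow> 2 \<le> card (leaves T \<inter> beyond T v s) \<Longrightarrow>
      card M \<le> card (leaves T \<inter> beyond T v x)"
proof -
  let ?L = "\<lambda>s. card (leaves T \<inter> beyond T v s)"
  have MV: "M \<subseteq> pverts T" using gp by (simp add: general_position_iff)
  then have fM: "finite M" using pair_finite_verts finite_subset by blast
  have xv: "x \<in> pverts T" "x \<noteq> v" using x by (auto dest: wellformed' no_loops)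
  have in_branch: "s \<in> beyond T v x" if s: "s \<in> M - {v}" for s
  proof -
    have "joined T v x u" using in_beyond_nbr_iff[OF x(1)] x(2) uv MV by auto
    moreover have "joined T v u s"
      using gp_joined[OF gp uv(2,1), of s] s uv by (cases "s = u") (auto simp: joined_refl)
    ultimately show ?thesis using in_beyond_nbr_iff[OF x(1)] s MV joined_trans by blast
  qed
  have "(\<Sum>s\<in>M - {v}. ?L s) = card (\<Union>s\<in>M - {v}. leaves T \<inter> beyond T v s)"
  proof (intro card_UN_disjoint[symmetric] ballI impI)
    fix s s' assume "s \<in> M - {v}" "s' \<in> M - {v}" "s \<noteq> s'"
    then have "beyond T v s \<inter> beyond T v s' = {}"
      using MV uv gp_joined[OF gp, of v s s'] gp_joined[OF gp, of v s' s]
      by (intro beyond_disjoint) auto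
    then show "(leaves T \<inter> beyond T v s) \<inter> (leaves T \<inter> beyond T v s') = {}" by blast
  qed (use fM finite_leaves in auto)
  also have "\<dots> \<le> ?L x"
  proof (intro card_mono)
    show "(\<Union>s\<in>M - {v}. leaves T \<inter> beyond T v s) \<subseteq> leaves T \<inter> beyond T v x"
      using in_branch beyond_trans[of v x] xv MV uv by blast
  qed (simp add: finite_leaves)
  finally have le: "(\<Sum>s\<in>M - {v}. ?L s) \<le> ?L x" .
  have pos: "1 \<le> ?L s" if "s \<in> M - {v}" for s
    using leaf_beyond[of v s] that MV uv finite_leaves
    by (auto simp: Suc_le_eq card_gt_0_iff)
  have M: "card M = Suc (card (M - {v}))" using card_Suc_Diff1[OF fM uv(1)] by simp
  have "card (M - {v}) \<le> (\<Sum>s\<in>M - {v}. ?L s)"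
    unfolding card_eq_sum[of "M - {v}"] by (intro sum_mono pos)
  with le M show "card M \<le> 1 + ?L x" by simp
  show "card M \<le> ?L x" if s: "s \<in> M" "s \<noteq> v" "2 \<le> ?L s"
  proof -
    have "card (M - {v} - {s}) \<le> (\<Sum>s\<in>M - {v} - {s}. ?L s)"
      unfolding card_eq_sum[of "M - {v} - {s}"] by (intro sum_mono pos) auto
    moreover have "(\<Sum>s\<in>M - {v}. ?L s) = ?L s + (\<Sum>s\<in>M - {v} - {s}. ?L s)"
      using fM s by (intro sum.remove) auto
    moreover have "card (M - {v}) = Suc (card (M - {v} - {s}))"
      using fM s by (intro card.remove) auto
    ultimately show ?thesis using le M s by linarith
  qed
qed

text \<open>
  If the leaf \<open>f\<close> cannot be marked any more, then some marked vertex \<open>s\<close> separates it from another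
  marked vertex, because \<open>f\<close> itself separates nothing.  As \<open>s\<close> does not separate marked vertices from
  each other, it separates \<open>f\<close> from \<open>v\<close>.
\<close>

lemma maximal_covers_leaf:
  assumes M: "maximal_general_position T M" and uv: "v \<in> M" "u \<in> M" "u \<noteq> v"
    and f: "f \<in> leaves T" "f \<noteq> v" "joined T v u f"
  obtains s where "s \<in> M - {v}" "f \<in> beyond T v s"
proof (cases "f \<in> M")
  case True
  then show thesis using that[of f] self_in_beyond f by (auto simp: leaves_def)
next
  case False
  have gp: "general_position T M" using M by (simp add: maximal_general_position_def)
  then have MV: "M \<subseteq> pverts T" by (simp add: general_position_iff)
  have fV: "f \<in> pverts T" using f by (simp add: leaves_def)
  then have "\<not> general_position T (insert f M)"
    using M False by (auto simp: maximal_general_position_def legal_moves_def)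
  then obtain a b c where abc: "a \<in> insert f M" "b \<in> insert f M" "c \<in> insert f M"
      "a \<noteq> b" "b \<noteq> c" "a \<noteq> c" "\<not> joined T b a c"
    using MV fV by (auto simp: general_position_iff)
  have "b \<noteq> f" using abc joined_leaf[OF f(1), of a c] MV by auto
  moreover have "a = f \<or> c = f" using abc gp_joined[OF gp, of a b c] \<open>b \<noteq> f\<close> by auto
  ultimately obtain s c' where s: "s \<in> M" "c' \<in> M" "s \<noteq> c'" "\<not> joined T s f c'"
    using abc joined_sym by blast
  have "s \<noteq> v"
  proof
    assume "s = v"
    then have "joined T v u c'"
      using gp_joined[OF gp, of u v c'] s uv by (cases "c' = u") (auto simp: joined_refl)
    then show False using s f \<open>s = v\<close> joined_trans joined_sym by blast
  qed
  have "\<not> joined T s v f"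
  proof
    assume j: "joined T s v f"
    have "joined T s v c'"
      using gp_joined[OF gp, of v s c'] s uv \<open>s \<noteq> v\<close> by (cases "c' = v") (auto simp: joined_refl)
    then show False using s j joined_trans joined_sym by blast
  qed
  then show thesis using that[of s] s \<open>s \<noteq> v\<close> fV by (simp add: in_beyond_iff)
qed

text \<open>
  Each leaf of \<open>F\<close> is behind a marked vertex, so \<open>F\<close> is not larger than \<open>M - {v}\<close> if no marked
  vertex \<open>s\<close> has two of them behind it.  This is the case if two leaves behind \<open>s\<close> always entail a
  vertex \<open>x\<close> behind \<open>s\<close> that lies between \<open>v\<close> and \<open>u\<close>: then also \<open>u\<close> would be behind \<open>s\<close>, and \<open>s\<close>
  would separate \<open>u\<close> from \<open>v\<close>.
\<close>

lemma card_maximal_ge: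
  assumes M: "maximal_general_position T M" and uv: "v \<in> M" "u \<in> M" "u \<noteq> v"
    and F: "F \<subseteq> leaves T" "\<And>f. f \<in> F \<Longrightarrow> f \<noteq> v \<and> joined T v u f"
    and sep: "\<And>s f g. s \<in> M - {v} \<Longrightarrow> f \<in> F \<Longrightarrow> g \<in> F \<Longrightarrow> f \<noteq> g \<Longrightarrow>
      f \<in> beyond T v s \<Longrightarrow> g \<in> beyond T v s \<Longrightarrow>
      \<exists>x \<in> beyond T v s. x \<noteq> u \<and> \<not> joined T x v u"
  shows "card F + 1 \<le> card M"
proof -
  have gp: "general_position T M" using M by (simp add: maximal_general_position_def)
  then have MV: "M \<subseteq> pverts T" by (simp add: general_position_iff)
  then have fM: "finite M" using pair_finite_verts finite_subset by blast
  have one: "card (F \<inter> beyond T v s) \<le> 1" if s: "s \<in> M - {v}" for s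
  proof (rule ccontr)
    assume "\<not> ?thesis"
    then obtain f g where "f \<in> F" "g \<in> F" "f \<noteq> g" "f \<in> beyond T v s" "g \<in> beyond T v s"
      by (auto simp: not_le card_le_Suc0_iff_eq[OF finite_Int[OF disjI2[OF finite_beyond]]])
    then obtain x where x: "x \<in> beyond T v s" "x \<noteq> u" "\<not> joined T x v u"
      using sep[OF s] by blast
    have xV: "x \<in> pverts T" "x \<noteq> v" using x by (auto simp: in_beyond_iff joined_refl)
    have uV: "u \<in> pverts T" using MV uv by blast
    have ux: "u \<in> beyond T v x" using x uV by (auto simp: in_beyond_iff)
    show False
    proof (cases "s = u")
      case True
      then show False
        using beyond_psubset[of v x u] beyond_psubset[of v u x] ux x xV uV uv MV by blast
    next
      case False
      have "u \<in> beyond T v s" using beyond_trans[of v s x] x ux s MV uv by blast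
      then show False using gp_joined[OF gp, of v s u] s uv False by (auto simp: in_beyond_iff)
    qed
  qed
  have "F \<subseteq> (\<Union>s\<in>M - {v}. F \<inter> beyond T v s)"
    using maximal_covers_leaf[OF M uv] F by blast
  then have "card F \<le> card (\<Union>s\<in>M - {v}. F \<inter> beyond T v s)"
    using fM F(1) finite_leaves by (intro card_mono) (auto intro: finite_subset)
  also have "\<dots> \<le> (\<Sum>s\<in>M - {v}. card (F \<inter> beyond T v s))"
    using fM by (intro card_UN_le) auto
  also have "\<dots> \<le> card (M - {v})"
    unfolding card_eq_sum[of "M - {v}"] by (intro sum_mono one)
  also have "\<dots> + 1 = card M" using card_Suc_Diff1[OF fM uv(1)] by simp
  finally show ?thesis by simp
qed

end

section \<open>The value of the game and the shape of the tree\<close>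

text \<open>
  An intrinsic description of the family.  In a subdivision of the caterpillar with parameters
  \<open>t\<^sub>1, \<dots>, t\<^sub>k\<close> the spine contains all vertices of degree at least 3, there are \<open>t\<^sub>1 + \<dots> + t\<^sub>k\<close> leaves,
  and the last spine vertex, here the head of \<open>P\<close>, has degree \<open>t\<^sub>k + 1\<close>.  So the inequality says that
  \<open>t\<^sub>1 + \<dots> + t\<^sub>k\<^sub>-\<^sub>1 \<le> t\<^sub>k\<close>.
\<close>

definition heavy_ended_spine :: "'a pair_pre_digraph \<Rightarrow> 'a list \<Rightarrow> bool" where
  "heavy_ended_spine G P \<longleftrightarrow> vpath P (with_proj G) \<and>
     (\<forall>x \<in> pverts G. 3 \<le> deg G x \<longrightarrow> x \<in> set P) \<and>
     card (leaves G) + 2 \<le> 2 * deg G (hd P)"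

context tree_graph
begin

lemma arcD:
  assumes "(v, x) \<in> parcs T"
  shows "v \<in> pverts T" "x \<in> pverts T" "x \<noteq> v"
  using assms no_loops' by (auto dest: wellformed')

lemma joined_commute: "joined T m a c \<longleftrightarrow> joined T m c a"
  using joined_sym by blast

lemma joined_cong: "joined T m a b \<Longrightarrow> joined T m a c \<longleftrightarrow> joined T m b c"
  using joined_sym joined_trans by blast

lemma nbr_leaf_pos:
  assumes "x \<in> nbrs T v"
  shows "1 \<le> card (leaves T \<inter> beyond T v x)"
proof -
  have "v \<in> pverts T" "x \<in> pverts T" "x \<noteq> v"
    using assms by (auto simp: nbrs_def dest: wellformed' no_loops)
  then show ?thesis using leaf_beyond[of v x] finite_leaves by (auto simp: Suc_le_eq card_gt_0_iff)
qed

text \<open>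
  Each of the \<open>deg v - 1\<close> other branches of \<open>v\<close> contains a leaf.
\<close>

lemma branch_leaves_le:
  assumes "x \<in> nbrs T v"
  shows "card (leaves T \<inter> beyond T v x) + deg T v \<le> card (leaves T) + 1"
    and "y \<in> nbrs T v \<Longrightarrow> y \<noteq> x \<Longrightarrow> 2 \<le> card (leaves T \<inter> beyond T v y) \<Longrightarrow>
      card (leaves T \<inter> beyond T v x) + deg T v \<le> card (leaves T)"
proof -
  let ?L = "\<lambda>s. card (leaves T \<inter> beyond T v s)"
  have "v \<in> pverts T" using assms by (auto simp: nbrs_def dest: wellformed')
  then have "(\<Sum>y\<in>nbrs T v. ?L y) \<le> card (leaves T)"
    using sum_leaves_of_branches finite_leaves by (simp add: card_mono)
  then have le: "?L x + (\<Sum>y\<in>nbrs T v - {x}. ?L y) \<le> card (leaves T)"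
    using sum.remove[OF nbrs_finite assms, of ?L] by simp
  have d: "deg T v = Suc (card (nbrs T v - {x}))"
    using card_Suc_Diff1[OF nbrs_finite assms] by (simp add: deg_eq_card_nbrs)
  have "card (nbrs T v - {x}) \<le> (\<Sum>y\<in>nbrs T v - {x}. ?L y)"
    unfolding card_eq_sum[of "nbrs T v - {x}"] by (intro sum_mono nbr_leaf_pos) auto
  with le d show "?L x + deg T v \<le> card (leaves T) + 1" by linarith
  show "?L x + deg T v \<le> card (leaves T)" if y: "y \<in> nbrs T v" "y \<noteq> x" "2 \<le> ?L y"
  proof -
    have "(\<Sum>y\<in>nbrs T v - {x}. ?L y) = ?L y + (\<Sum>y\<in>nbrs T v - {x} - {y}. ?L y)"
      using y nbrs_finite by (intro sum.remove) auto
    moreover have "card (nbrs T v - {x} - {y}) \<le> (\<Sum>y\<in>nbrs T v - {x} - {y}. ?L y)"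
      unfolding card_eq_sum[of "nbrs T v - {x} - {y}"] by (intro sum_mono nbr_leaf_pos) auto
    moreover have "card (nbrs T v - {x}) = Suc (card (nbrs T v - {x} - {y}))"
      using y nbrs_finite by (intro card.remove) auto
    ultimately show ?thesis using le d y(3) by linarith
  qed
qed

lemma gp_game'_le:
  assumes "v \<in> pverts T" "2 \<le> card (pverts T)"
  shows "gp_game' T + deg T v \<le> card (leaves T) + 2"
proof -
  have "pverts T \<noteq> {v}" using assms by auto
  then obtain u M where M: "u \<in> pverts T - {v}" "{v, u} \<subseteq> M" "general_position T M" "gp_game' T \<le> card M"
    using builder_reply[OF pair_finite_verts assms(1)] by metis
  then obtain x where x: "(v, x) \<in> parcs T" "u \<in> beyond T v x"
    using ex_branch[of v u] assms by blast
  then have "card M \<le> 1 + card (leaves T \<inter> beyond T v x)"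
    using card_general_position_le(1)[OF M(3), of v u x] M by blast
  moreover have "card (leaves T \<inter> beyond T v x) + deg T v \<le> card (leaves T) + 1"
    using branch_leaves_le(1)[of x v] x by (simp add: nbrs_def)
  ultimately show ?thesis using M(4) by linarith
qed

text \<open>
  The hypothesis leaves no slack in the bounds for the opening \<open>v\<close>: in the branch of Builder's
  answer \<open>u\<close> every leaf counts, and each other branch has exactly one leaf.  This puts all branch
  vertices on the path from \<open>v\<close> to \<open>u\<close>.  For the inequality, consider the opening at the lowest vertex
  \<open>x0\<close> that has all leaves of that branch behind it.  If Builder answers below \<open>x0\<close>, at least one
  of these leaves is lost; if Builder answers above \<open>x0\<close>, all of them are lost, and only
  \<open>deg v - 1\<close> leaves remain.
\<close>

lemma spine_if_game_large:
  assumes v: "v \<in> pverts T" and card: "2 \<le> card (pverts T)"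
    and large: "card (leaves T) + 2 \<le> gp_game' T + deg T v"
  shows "\<exists>P. heavy_ended_spine T P"
proof -
  let ?L = "\<lambda>v s. card (leaves T \<inter> beyond T v s)"
  have "pverts T \<noteq> {v}" using card by auto
  then obtain u M where u: "u \<in> pverts T - {v}"
    and M: "{v, u} \<subseteq> M" "general_position T M" "gp_game' T \<le> card M"
    and third: "\<And>w. w \<notin> {v, u} \<Longrightarrow> general_position T {v, u, w} \<Longrightarrow>
      \<exists>M. {v, u, w} \<subseteq> M \<and> general_position T M \<and> gp_game' T \<le> card M"
    using builder_reply[OF pair_finite_verts v] by metis
  obtain x where x: "(v, x) \<in> parcs T" "u \<in> beyond T v x"
    using ex_branch[of v u] v u by blast
  have xn: "x \<in> nbrs T v" and xv: "x \<in> pverts T" "x \<noteq> v"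
    using x by (auto simp: nbrs_def dest: wellformed' no_loops)
  have Lx: "?L v x + deg T v = card (leaves T) + 1"
    using card_general_position_le(1)[OF M(2), of v u x] M u x branch_leaves_le(1)[OF xn] large by auto
  \<comment> \<open>A marked vertex with two leaves behind it would waste one of them.\<close>
  have tight: "\<not> 2 \<le> ?L v s"
    if "{v, u, s} \<subseteq> M'" "s \<noteq> v" "general_position T M'" "gp_game' T \<le> card M'" for s M'
    using card_general_position_le(2)[OF that(3), of v u x s] that u x Lx large by auto
  have others: "\<not> 2 \<le> ?L v y" if "y \<in> nbrs T v" "y \<noteq> x" for y
    using branch_leaves_le(2)[OF xn that] Lx by auto
  have on_path: "\<not> joined T b v u" if b: "b \<in> pverts T" "3 \<le> deg T b" "b \<noteq> v" for b
  proof
    assume j: "joined T b v u"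
    have two: "2 \<le> ?L v s" if "b \<in> beyond T v s" "s \<in> pverts T" "s \<noteq> v" for s
    proof -
      have "2 \<le> ?L v b" using two_leaves_beyond_branch_vertex b v by blast
      also have "\<dots> \<le> ?L v s"
        using beyond_trans[of v s b] that v finite_leaves by (intro card_mono) auto
      finally show ?thesis .
    qed
    \<comment> \<open>Neither another branch nor the set behind \<open>u\<close> has room for \<open>b\<close>, so Blocker could mark it.\<close>
    obtain y where y: "(v, y) \<in> parcs T" "b \<in> beyond T v y" using ex_branch[of v b] v b by blast
    then have "2 \<le> ?L v y" using two arcD[OF y(1)] by blast
    then have "y = x" using others y by (auto simp: nbrs_def)
    have "joined T v u b"
      using y x in_beyond_nbr_iff[OF x(1)] b u \<open>y = x\<close> joined_trans joined_sym by blast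
    moreover have "b \<notin> beyond T v u" using two[of u] tight[of u M] M u by auto
    moreover have "b \<noteq> u" using self_in_beyond calculation(2) u by blast
    ultimately have "general_position T {v, u, b}"
      using b v u j joined_sym by (auto simp: general_position_iff in_beyond_iff)
    then obtain M' where "{v, u, b} \<subseteq> M'" "general_position T M'" "gp_game' T \<le> card M'"
      using third[of b] b \<open>b \<noteq> u\<close> by blast
    then show False using tight[of b M'] two[of b] self_in_beyond b by blast
  qed
  obtain P where P: "vpath P (with_proj T)" "hd P = v" "last P = u"
    using ex_vpath v u by blast
  have branch: "b \<in> set P" if "b \<in> pverts T" "3 \<le> deg T b" for b
  proof (cases "b = v")
    case True
    then show ?thesis using P by (auto simp: vpath_def vwalk_def)
  next
    case False
    then show ?thesis using on_path[of b] vwalk_imp_joined[of P T b] P that by auto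
  qed
  have "card (leaves T) + 2 \<le> 2 * deg T v"
  proof (rule ccontr)
    assume few: "\<not> ?thesis"
    let ?F = "leaves T \<inter> beyond T v x"
    obtain x0 where x0: "x0 \<in> beyond T v x" "?F \<subseteq> beyond T v x0"
      and low: "\<And>y. y \<in> nbrs T x0 \<Longrightarrow> y \<in> beyond T v x0 \<Longrightarrow> \<not> ?F \<subseteq> beyond T v y"
      using ex_lowest[of v x ?F] v xv by blast
    have x0v: "x0 \<in> pverts T" "x0 \<noteq> v" using x0 by (auto simp: in_beyond_iff joined_refl)
    then obtain u' M' where u': "u' \<in> pverts T - {x0}"
      and M': "{x0, u'} \<subseteq> M'" "general_position T M'" "gp_game' T \<le> card M'"
      using builder_reply[OF pair_finite_verts, of x0] v by (metis singletonD)
    obtain y where y: "(x0, y) \<in> parcs T" "u' \<in> beyond T x0 y"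
      using ex_branch[of x0 u'] u' x0v by blast
    have le: "card M' \<le> 1 + ?L x0 y"
      using card_general_position_le(1)[OF M'(2), of x0 u' y] M' u' y by blast
    have yn: "y \<in> nbrs T x0" using y by (simp add: nbrs_def)
    show False
    proof (cases "y \<in> beyond T v x0")
      case True
      have eq: "beyond T x0 y = beyond T v y" using child_props(3)[of v x0 y] v x0v yn True by blast
      have "beyond T v y \<subseteq> beyond T v x"
        using beyond_trans[of v x0 y] beyond_trans[of v x x0] True x0(1) x0v xv v by blast
      then have "leaves T \<inter> beyond T v y \<subset> ?F" using low[OF yn True] by blast
      then have "?L x0 y < ?L v x" unfolding eq by (intro psubset_card_mono) (simp add: finite_leaves)
      then show False using le Lx large M'(3) by linarith
    next
      case False
      then have "joined T x0 v y" using y by (auto simp: in_beyond_iff dest: wellformed')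
      then have "z \<notin> beyond T v x0" if "z \<in> beyond T x0 y" for z
        using in_beyond_nbr_iff[OF y(1), of z] that root_notin_beyond[of x0 y] joined_trans
        by (auto simp: in_beyond_iff)
      then have "leaves T \<inter> beyond T x0 y \<subseteq> leaves T - ?F" using x0(2) by blast
      then have "?L x0 y \<le> card (leaves T - ?F)" by (intro card_mono) (simp add: finite_leaves)
      also have "\<dots> = card (leaves T) - ?L v x"
        by (intro card_Diff_subset) (auto simp: finite_leaves)
      finally show False using le Lx large M'(3) few by linarith
    qed
  qed
  then show ?thesis
    using P branch unfolding heavy_ended_spine_def by blast
qed

text \<open>
  Let \<open>z\<close> be the heavy end of the spine, \<open>b\<close> a leaf at its other end and \<open>B\<close> the branch of \<open>z\<close> that
  contains \<open>b\<close>.  The other branches of \<open>z\<close> are paths, so \<open>B\<close> contains \<open>\<ell> - deg z + 1\<close> leaves, and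
  the leaves outside \<open>B\<close> are at least as many.  If Blocker starts outside \<open>B\<close>, Builder answers \<open>b\<close> and
  all branch vertices except possibly the opening itself lie between the two; so all leaves of \<open>B\<close>
  are saved.  If Blocker starts in \<open>B\<close>, Builder answers with a leaf \<open>a\<close> outside \<open>B\<close>.  Then \<open>z\<close> lies between the two and is
  behind every vertex that has two leaves outside \<open>B\<close> behind it; so these leaves are saved.
\<close>

lemma game_large_if_spine:
  assumes P: "heavy_ended_spine T P" and card: "2 \<le> card (pverts T)"
  shows "card (leaves T) + 2 \<le> gp_game' T + deg T (hd P)"
proof -
  define z where "z = hd P"
  have path: "vpath P (with_proj T)" and heavy: "card (leaves T) + 2 \<le> 2 * deg T z"
    using P by (auto simp: heavy_ended_spine_def z_def)
  have Pne: "P \<noteq> []" using path by (auto simp: vpath_def)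
  have zV: "z \<in> pverts T" using path Pne by (auto simp: vpath_def vwalk_def z_def)
  have ex_other: "\<exists>y. y \<in> pverts T \<and> y \<noteq> z"
  proof (rule ccontr)
    assume "\<not> ?thesis"
    then have "pverts T \<subseteq> {z}" by auto
    then have "card (pverts T) \<le> 1" using card_mono[of "{z}"] by fastforce
    then show False using card by simp
  qed
  have "leaves T \<noteq> {}" using ex_other leaf_beyond zV by blast
  then have "1 \<le> card (leaves T)" using finite_leaves by (simp add: Suc_le_eq card_gt_0_iff)
  then have deg_z: "2 \<le> deg T z" using heavy by linarith
  then have z_noleaf: "z \<notin> leaves T" by (simp add: leaves_def)
  \<comment> \<open>The end of the spine is behind all branch vertices; if the spine is just \<open>z\<close>, any vertex will do.\<close>
  have "\<exists>y. y \<in> pverts T \<and> y \<noteq> z \<and> (\<forall>x\<in>pverts T. 3 \<le> deg T x \<longrightarrow> x \<noteq> z \<longrightarrow> y \<in> beyond T z x)"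
  proof (cases "last P = z")
    case True
    then have "P = [z]" using path Pne unfolding z_def vpath_def
      by (metis distinct.simps(2) hd_Cons_tl last_ConsR last_in_set)
    then have "x = z" if "x \<in> pverts T" "3 \<le> deg T x" for x
      using P that by (auto simp: heavy_ended_spine_def)
    then show ?thesis using ex_other by blast
  next
    case False
    show ?thesis
    proof (intro exI conjI ballI impI)
      show "last P \<in> pverts T" using path Pne by (auto simp: vpath_def vwalk_def)
      fix x assume x: "x \<in> pverts T" "3 \<le> deg T x" "x \<noteq> z"
      show "last P \<in> beyond T z x"
      proof (cases "last P = x")
        case False
        have "x \<in> set P" using P x by (auto simp: heavy_ended_spine_def)
        then obtain p q where pq: "P = p @ x # q" by (auto dest: split_list)
        moreover have "p \<noteq> []" using pq x(3) by (auto simp: z_def)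
        moreover have "q \<noteq> []" using pq False by auto
        ultimately have "\<not> joined T x z (last P)"
          using interior_separates[of p x q] path by (simp add: z_def)
        then show ?thesis using \<open>last P \<in> pverts T\<close> by (simp add: in_beyond_iff)
      qed (use x self_in_beyond in auto)
    qed (use False in auto)
  qed
  then obtain y where y: "y \<in> pverts T" "y \<noteq> z"
    "\<And>x. x \<in> pverts T \<Longrightarrow> 3 \<le> deg T x \<Longrightarrow> x \<noteq> z \<Longrightarrow> y \<in> beyond T z x" by blast
  then obtain b where b: "b \<in> leaves T" "b \<in> beyond T z y" using leaf_beyond zV by blast
  have bV: "b \<in> pverts T" "b \<noteq> z" using b by (auto simp: in_beyond_iff joined_refl)
  have above_b: "b \<in> beyond T z x" if "x \<in> pverts T" "3 \<le> deg T x" "x \<noteq> z" for x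
    using beyond_trans[of z x y] y(3) that zV b by blast
  have branch_not_leaf: "x \<notin> leaves T" if "3 \<le> deg T x" for x
    using that by (simp add: leaves_def)
  obtain xb where xb: "(z, xb) \<in> parcs T" "b \<in> beyond T z xb" using ex_branch zV bV by blast
  define B where "B = beyond T z xb"
  have in_B: "s \<in> B" if s: "s \<in> pverts T" "s \<noteq> z" "b \<in> beyond T z s" for s
  proof -
    obtain x' where x': "(z, x') \<in> parcs T" "s \<in> beyond T z x'" using ex_branch zV s by blast
    then have "b \<in> beyond T z x'"
      using beyond_trans[of z x' s] arcD[OF x'(1)] s by blast
    then have "x' = xb" using branches_disjoint[OF x'(1) xb(1)] xb(2) by blast
    then show ?thesis using x' by (simp add: B_def)
  qed
  have B_joined: "f \<in> B \<longleftrightarrow> joined T z b f" if "f \<in> pverts T" "f \<noteq> z" for f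
  proof -
    have "joined T z xb b" using in_beyond_nbr_iff[OF xb(1)] xb(2) bV by blast
    then show ?thesis
      using in_beyond_nbr_iff[OF xb(1), of f] that joined_cong unfolding B_def by simp
  qed
  have bB: "b \<in> B" using xb by (simp add: B_def)
  have zB: "z \<notin> B" by (simp add: B_def root_notin_beyond)
  have leafV: "f \<in> leaves T \<Longrightarrow> f \<in> pverts T" for f by (simp add: leaves_def)
  \<comment> \<open>All branches at \<open>z\<close> but one are paths.\<close>
  have one: "card (leaves T \<inter> beyond T z x') = 1" if x': "x' \<in> nbrs T z - {xb}" for x'
  proof (rule ccontr)
    assume "\<not> ?thesis"
    then have "\<not> card (leaves T \<inter> beyond T z x') \<le> Suc 0"
      using nbr_leaf_pos[of x' z] x' by auto
    then obtain f g where fg: "f \<in> leaves T" "g \<in> leaves T" "f \<noteq> g" "f \<in> beyond T z x'" "g \<in> beyond T z x'"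
      using finite_leaves by (auto simp: card_le_Suc0_iff_eq)
    moreover have "x' \<in> pverts T" "x' \<noteq> z"
      using x' by (auto simp: nbrs_def dest: wellformed' no_loops)
    ultimately obtain x where x: "x \<in> beyond T z x'" "3 \<le> deg T x"
      using branch_vertex_above_two_leaves[of z x' f g] zV by blast
    have "x \<in> pverts T" "x \<noteq> z" using x by (auto simp: in_beyond_iff joined_refl)
    then have "x \<in> B" using in_B[of x] above_b[of x] x by blast
    then show False using branches_disjoint[of z x' xb] x x' xb by (auto simp: nbrs_def B_def)
  qed
  have "card (leaves T) = (\<Sum>x\<in>nbrs T z. card (leaves T \<inter> beyond T z x))"
    using sum_leaves_of_branches[OF zV] z_noleaf by simp
  also have "\<dots> = card (leaves T \<inter> B) + (\<Sum>x\<in>nbrs T z - {xb}. card (leaves T \<inter> beyond T z x))"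
    using sum.remove[OF nbrs_finite, of xb z] xb by (simp add: nbrs_def B_def)
  also have "(\<Sum>x\<in>nbrs T z - {xb}. card (leaves T \<inter> beyond T z x)) = card (nbrs T z - {xb})"
    using one by simp
  also have "card (nbrs T z - {xb}) = deg T z - 1"
    using xb nbrs_finite by (simp add: deg_eq_card_nbrs nbrs_def)
  finally have count: "card (leaves T) + 1 = card (leaves T \<inter> B) + deg T z"
    using deg_z by linarith
  have "card (leaves T \<inter> B) + 1 \<le> gp_game' T"
  proof (rule gp_game'_lower_bound)
    fix v assume v: "v \<in> pverts T"
    show "\<exists>u\<in>pverts T - {v}. \<forall>M. {v, u} \<subseteq> M \<longrightarrow> maximal_general_position T M \<longrightarrow>
      card (leaves T \<inter> B) + 1 \<le> card M"
    proof (cases "v \<in> B")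
      case False
      \<comment> \<open>The opening cannot separate \<open>B\<close> from \<open>z\<close>, being outside \<open>B\<close>.\<close>
      have to_z: "joined T v f z" if f: "f \<in> B" "v \<noteq> z" for f
      proof -
        have "f \<in> pverts T" "f \<noteq> z" "f \<noteq> v" using f False zB by (auto simp: B_def in_beyond_iff)
        moreover have "\<not> joined T z f v"
          using B_joined[of f] B_joined[of v] joined_cong[of z b f v] calculation f v False by simp
        ultimately show ?thesis using joined_or_joined[of f z v] zV f(2) by auto
      qed
      have bv: "b \<noteq> v" using False bB by blast
      have "card (leaves T \<inter> B) + 1 \<le> card M"
        if M: "{v, b} \<subseteq> M" "maximal_general_position T M" for M
      proof (rule card_maximal_ge[OF M(2)])
        show "v \<in> M" "b \<in> M" "b \<noteq> v" using M bv by auto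
        show "leaves T \<inter> B \<subseteq> leaves T" by simp
        show "f \<noteq> v \<and> joined T v b f" if f: "f \<in> leaves T \<inter> B" for f
        proof (cases "v = z")
          case True
          then show ?thesis using B_joined[of f] f zB leafV by auto
        next
          case neq: False
          then show ?thesis using to_z[of f] to_z[of b] f bB False joined_cong[of v b z f] joined_commute[of v z f]
            by auto
        qed
        fix s f g assume s: "s \<in> M - {v}" and "f \<in> leaves T \<inter> B" "g \<in> leaves T \<inter> B" "f \<noteq> g"
          "f \<in> beyond T v s" "g \<in> beyond T v s"
        moreover have "s \<in> pverts T"
          using s M by (auto simp: maximal_general_position_def general_position_def)
        ultimately obtain x where x: "x \<in> beyond T v s" "3 \<le> deg T x"
          using branch_vertex_above_two_leaves[of v s f g] v by blast
        have xV: "x \<in> pverts T" "x \<noteq> v" using x by (auto simp: in_beyond_iff joined_refl)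
        have "\<not> joined T x v b"
        proof (cases "x = z")
          case True
          then show ?thesis using B_joined[of v] v False xV joined_commute[of z v b] by simp
        next
          case xz: False
          then have bx: "b \<in> beyond T z x" using above_b x xV by blast
          then have "x \<in> B" using in_B xV xz by blast
          have "joined T x z v"
          proof (cases "v = z")
            case False
            have "\<not> joined T z v x"
              using B_joined[of v] B_joined[of x] \<open>x \<in> B\<close> \<open>v \<notin> B\<close> xV xz v False
                joined_cong[of z b x v] joined_commute[of z v x]
              by simp
            then show ?thesis
              using joined_or_joined[of v x z] xV xz v False joined_commute[of x v z] by auto
          qed (simp add: joined_refl)
          then show ?thesis using bx joined_cong[of x z v b] by (simp add: in_beyond_iff)
        qed
        moreover have "x \<noteq> b" using x b branch_not_leaf by blast
        ultimately show "\<exists>x\<in>beyond T v s. x \<noteq> b \<and> \<not> joined T x v b" using x by blast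
      qed
      then show ?thesis using bV bv by (intro bexI[of _ b]) auto
    next
      case True
      then have vz: "v \<noteq> z" using zB by blast
      have "card (nbrs T z - {xb}) = deg T z - 1"
        using xb nbrs_finite by (simp add: deg_eq_card_nbrs nbrs_def)
      then have "card (nbrs T z - {xb}) \<noteq> 0" using deg_z by linarith
      then have "nbrs T z - {xb} \<noteq> {}" by (metis card.empty)
      then obtain x' where x': "x' \<in> nbrs T z" "x' \<noteq> xb" by blast
      then have "x' \<in> pverts T" "x' \<noteq> z" by (auto simp: nbrs_def dest: wellformed' no_loops)
      then obtain a where a: "a \<in> leaves T" "a \<in> beyond T z x'" using leaf_beyond zV by blast
      then have aB: "a \<notin> B" using branches_disjoint[of z x' xb] x' xb by (auto simp: nbrs_def B_def)
      have az: "a \<noteq> z" "a \<noteq> v" using a z_noleaf aB True by auto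
      \<comment> \<open>The opening is in \<open>B\<close>, so it separates nothing outside \<open>B\<close> from \<open>z\<close>.\<close>
      have to_z: "joined T v f z" if f: "f \<in> leaves T - B" for f
      proof -
        have fz: "f \<noteq> z" "f \<noteq> v" "f \<in> pverts T" using f z_noleaf True leafV by auto
        then have "\<not> joined T z f v"
          using B_joined[of f] B_joined[of v] f v vz True joined_cong[of z b v f]
            joined_commute[of z f v] by simp
        then show ?thesis using joined_or_joined[of f z v] fz zV vz by auto
      qed
      have "card (leaves T - B) + 1 \<le> card M"
        if M: "{v, a} \<subseteq> M" "maximal_general_position T M" for M
      proof (rule card_maximal_ge[OF M(2)])
        show "v \<in> M" "a \<in> M" "a \<noteq> v" using M az by auto
        show "f \<noteq> v \<and> joined T v a f" if f: "f \<in> leaves T - B" for f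
          using to_z[of f] to_z[of a] f a aB True joined_cong[of v a z f] joined_commute[of v z f]
          by auto
        fix s f g assume s: "s \<in> M - {v}" and fg: "f \<in> leaves T - B" "g \<in> leaves T - B" "f \<noteq> g"
          "f \<in> beyond T v s" "g \<in> beyond T v s"
        have sV: "s \<in> pverts T"
          using s M by (auto simp: maximal_general_position_def general_position_def)
        \<comment> \<open>Otherwise two leaves outside \<open>B\<close> are behind \<open>s\<close> also when seen from \<open>z\<close>, hence a branch vertex, which puts \<open>s\<close> into \<open>B\<close>.\<close>
        have "z \<in> beyond T v s"
        proof (rule ccontr)
          assume "z \<notin> beyond T v s"
          then have j: "joined T s v z" using zV by (simp add: in_beyond_iff)
          then have sz: "s \<noteq> z" using not_joined_self vz by blast
          have fz: "f \<in> beyond T z s" "g \<in> beyond T z s"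
            using fg joined_cong[OF j] by (simp_all add: in_beyond_iff)
          then obtain x where x: "x \<in> beyond T z s" "3 \<le> deg T x"
            using branch_vertex_above_two_leaves[of z s f g] zV sV sz fg by blast
          have "x \<in> pverts T" "x \<noteq> z" using x by (auto simp: in_beyond_iff joined_refl)
          then have "b \<in> beyond T z s"
            using above_b[of x] x beyond_trans[of z s x] zV sV sz by blast
          then have "s \<in> B" using in_B sV sz by blast
          then have "beyond T z s \<subseteq> B"
            using beyond_trans[of z xb s] arcD[OF xb(1)] unfolding B_def by blast
          then show False using fz fg by blast
        qed
        moreover have "\<not> joined T z v a"
          using B_joined[of v] B_joined[of a] True aB az vz v leafV[OF a(1)] joined_cong[of z b v a]
          by simp
        ultimately show "\<exists>x\<in>beyond T v s. x \<noteq> a \<and> \<not> joined T x v a"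
          using az(1) by (intro bexI[of _ z]) auto
      qed auto
      moreover have "card (leaves T \<inter> B) \<le> card (leaves T - B)"
        using count heavy card_Int_Diff[OF finite_leaves, of B] by linarith
      ultimately show ?thesis using leafV[OF a(1)] az by (intro bexI[of _ a]) fastforce+
    qed
  qed (use pair_finite_verts zV in auto)
  with count show ?thesis unfolding z_def by linarith
qed

end

section \<open>Isomorphisms of pair digraphs\<close>

text \<open>
  For pair digraphs head and tail are the projections, so an isomorphism is determined by its map on
  vertices.
\<close>

definition pair_iso :: "('a \<Rightarrow> 'b) \<Rightarrow> 'a pair_pre_digraph \<Rightarrow> 'b pair_pre_digraph \<Rightarrow> bool" where
  "pair_iso \<phi> G H \<longleftrightarrow> inj_on \<phi> (pverts G) \<and> pverts H = \<phi> ` pverts G \<and>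
     parcs H = map_prod \<phi> \<phi> ` parcs G"

lemma digraph_iso_iff_pair_iso:
  assumes "pair_wf_digraph G"
  shows "digraph_iso (with_proj G) (with_proj H) \<longleftrightarrow> (\<exists>\<phi>. pair_iso \<phi> G H)"
proof
  assume "digraph_iso (with_proj G) (with_proj H)"
  then obtain f where f: "pre_digraph.digraph_isomorphism (with_proj G) f"
    and H: "with_proj H = app_iso f (with_proj G)" by (auto simp: digraph_iso_def)
  have V: "pverts H = iso_verts f ` pverts G" and A: "parcs H = iso_arcs f ` parcs G"
    and t: "fst = iso_tail f" and h: "snd = iso_head f"
    using H by (metis with_proj_simps(1) verts_app_iso, metis with_proj_simps(2) arcs_app_iso,
        metis with_proj_simps(4) tail_app_iso, metis with_proj_simps(5) head_app_iso)
  have "iso_arcs f a = map_prod (iso_verts f) (iso_verts f) a" if "a \<in> parcs G" for a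
    using f that unfolding pre_digraph.digraph_isomorphism_def
    by (auto simp: t[symmetric] h[symmetric] prod_eq_iff)
  then have "pair_iso (iso_verts f) G H"
    using f V A by (auto simp: pair_iso_def pre_digraph.digraph_isomorphism_def)
  then show "\<exists>\<phi>. pair_iso \<phi> G H" by blast
next
  assume "\<exists>\<phi>. pair_iso \<phi> G H"
  then obtain \<phi> where \<phi>: "pair_iso \<phi> G H" ..
  interpret pair_wf_digraph G by fact
  let ?f = "\<lparr> iso_verts = \<phi>, iso_arcs = map_prod \<phi> \<phi>, iso_head = snd, iso_tail = fst \<rparr>"
  have "inj_on (map_prod \<phi> \<phi>) (pverts G \<times> pverts G)"
    using \<phi> by (intro map_prod_inj_on) (auto simp: pair_iso_def)
  then have "inj_on (map_prod \<phi> \<phi>) (parcs G)"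
    by (rule inj_on_subset) (auto dest: wellformed')
  then have "digraph_isomorphism ?f"
    using \<phi> wf_digraph unfolding digraph_isomorphism_def pair_iso_def by auto
  moreover have "with_proj H = app_iso ?f (with_proj G)"
    using \<phi> by (simp add: app_iso_def pair_iso_def with_proj_def)
  ultimately show "digraph_iso (with_proj G) (with_proj H)"
    unfolding digraph_iso_def by blast
qed

lemma vwalk_arcs_map: "vwalk_arcs (map f p) = map (map_prod f f) (vwalk_arcs p)"
  by (induction p rule: vwalk_arcs.induct) auto

lemma pair_iso_nbrs:
  assumes "pair_iso \<phi> G H" "pair_wf_digraph G" "x \<in> pverts G"
  shows "nbrs H (\<phi> x) = \<phi> ` nbrs G x"
proof -
  interpret pair_wf_digraph G by fact
  have "x' = x" if "(x', y) \<in> parcs G" "\<phi> x' = \<phi> x" for x' y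
    using assms that by (auto simp: pair_iso_def dest: inj_onD in_arcsD1)
  then show ?thesis using assms(1) by (force simp: nbrs_def pair_iso_def)
qed

lemma pair_iso_deg:
  assumes "pair_iso \<phi> G H" "pair_wf_digraph G" "x \<in> pverts G"
  shows "deg H (\<phi> x) = deg G x"
proof -
  interpret pair_wf_digraph G by fact
  have "nbrs G x \<subseteq> pverts G" by (auto simp: nbrs_def dest: in_arcsD2)
  then have "inj_on \<phi> (nbrs G x)"
    using assms(1) by (auto simp: pair_iso_def intro: inj_on_subset)
  then show ?thesis by (simp add: deg_eq_card_nbrs pair_iso_nbrs[OF assms] card_image)
qed

lemma pair_iso_leaves:
  assumes "pair_iso \<phi> G H" "pair_wf_digraph G"
  shows "leaves H = \<phi> ` leaves G" "card (leaves H) = card (leaves G)"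
proof -
  show eq: "leaves H = \<phi> ` leaves G"
    using assms(1) pair_iso_deg[OF assms] by (auto simp: leaves_def pair_iso_def)
  have "inj_on \<phi> (leaves G)"
    using assms(1) by (auto simp: pair_iso_def leaves_def intro: inj_on_subset)
  then show "card (leaves H) = card (leaves G)" unfolding eq by (rule card_image)
qed

lemma pair_iso_spine:
  assumes iso: "pair_iso \<phi> G H" and wf: "pair_wf_digraph G" and P: "heavy_ended_spine G P"
  shows "heavy_ended_spine H (map \<phi> P)"
  unfolding heavy_ended_spine_def
proof (intro conjI ballI impI)
  have w: "vwalk P (with_proj G)" "distinct P" "P \<noteq> []"
    using P by (auto simp: heavy_ended_spine_def vpath_def)
  then have hdV: "hd P \<in> pverts G" "set P \<subseteq> pverts G" by (auto simp: vwalk_def)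
  have "distinct (map \<phi> P)"
    using iso w hdV by (auto simp: distinct_map pair_iso_def intro: inj_on_subset)
  moreover have "vwalk (map \<phi> P) (with_proj H)"
    using iso w by (auto simp: vwalk_def pair_iso_def vwalk_arcs_map)
  ultimately show "vpath (map \<phi> P) (with_proj H)" by (simp add: vpath_def)
  show "card (leaves H) + 2 \<le> 2 * deg H (hd (map \<phi> P))"
    using P pair_iso_deg[OF iso wf hdV(1)] pair_iso_leaves(2)[OF iso wf] w(3)
    by (simp add: heavy_ended_spine_def hd_map)
  fix y assume y: "y \<in> pverts H" "3 \<le> deg H y"
  then obtain x where x: "x \<in> pverts G" "y = \<phi> x" using iso by (auto simp: pair_iso_def)
  then show "y \<in> set (map \<phi> P)"
    using P y pair_iso_deg[OF iso wf x(1)] by (auto simp: heavy_ended_spine_def)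
qed

section \<open>Subdividing an edge\<close>

lemma subdivide_nbrs:
  assumes "pair_graph G" "(u, v) \<in> parcs G" "w \<notin> pverts G"
  shows "nbrs (subdivide G (u, v) w) w = {u, v}"
    and "x \<in> pverts G \<Longrightarrow> nbrs (subdivide G (u, v) w) x =
      (if x = u then insert w (nbrs G u - {v}) else if x = v then insert w (nbrs G v - {u})
       else nbrs G x)"
proof -
  interpret pair_graph G by fact
  have "u \<in> pverts G" "v \<in> pverts G" "u \<noteq> v"
    using assms(2) no_loops' by (auto dest: wellformed')
  then show "nbrs (subdivide G (u, v) w) w = {u, v}"
    using assms(3) by (auto simp: nbrs_def dest: wellformed')
  show "nbrs (subdivide G (u, v) w) x =
      (if x = u then insert w (nbrs G u - {v}) else if x = v then insert w (nbrs G v - {u})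
       else nbrs G x)" if "x \<in> pverts G"
    using \<open>u \<in> pverts G\<close> \<open>v \<in> pverts G\<close> \<open>u \<noteq> v\<close> that assms(3) by (auto simp: nbrs_def)
qed

text \<open>
  In the neighbourhood of \<open>u\<close> the new vertex takes the place of \<open>v\<close>, and vice versa.
\<close>

lemma subdivide_deg:
  assumes G: "pair_graph G" "(u, v) \<in> parcs G" "w \<notin> pverts G"
  shows "deg (subdivide G (u, v) w) w = 2"
    and "x \<in> pverts G \<Longrightarrow> deg (subdivide G (u, v) w) x = deg G x"
proof -
  interpret pair_graph G by fact
  have "u \<noteq> v" using assms(2) no_loops' by auto
  then show "deg (subdivide G (u, v) w) w = 2"
    by (simp add: deg_eq_card_nbrs subdivide_nbrs(1)[OF G])
  have sub: "nbrs G x \<subseteq> pverts G" for x by (auto simp: nbrs_def dest: wellformed')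
  then have fin: "finite (nbrs G x)" for x using pair_finite_verts finite_subset by blast
  have exch: "card (insert w (nbrs G x - {y})) = card (nbrs G x)" if "y \<in> nbrs G x" for x y
    using that sub[of x] assms(3) fin[of x] card_Suc_Diff1[OF fin that] by (subst card_insert_disjoint) auto
  have "v \<in> nbrs G u" "u \<in> nbrs G v" using assms(2) arcs_symmetric by (auto simp: nbrs_def)
  then show "deg (subdivide G (u, v) w) x = deg G x" if "x \<in> pverts G"
    using exch by (simp add: deg_eq_card_nbrs subdivide_nbrs(2)[OF G that])
qed

lemma subdivide_leaves:
  assumes "pair_graph G" "(u, v) \<in> parcs G" "w \<notin> pverts G"
  shows "leaves (subdivide G (u, v) w) = leaves G"
  using subdivide_deg[OF assms] by (auto simp: leaves_def)

text \<open>
  The new vertex is inserted wherever the path uses the subdivided edge.  The last conjunct carries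
  the induction: it excludes that \<open>w\<close> has been inserted before, because \<open>u\<close> and \<open>v\<close> occur only once.
\<close>

lemma subdivide_vpath:
  assumes G: "pair_graph G" "(u, v) \<in> parcs G" "w \<notin> pverts G"
    and "vpath P (with_proj G)"
  shows "\<exists>P'. vpath P' (with_proj (subdivide G (u, v) w)) \<and> hd P' = hd P \<and>
    set P \<subseteq> set P' \<and> set P' \<subseteq> insert w (set P) \<and> (w \<in> set P' \<longrightarrow> u \<in> set P \<and> v \<in> set P)"
proof -
  interpret pair_graph G by fact
  let ?H = "subdivide G (u, v) w"
  have uv: "u \<noteq> w" "v \<noteq> w" "u \<noteq> v" using assms(2,3) no_loops' by (auto dest: wellformed')
  have "vwalk P (with_proj G)" "distinct P" using assms(4) by (auto simp: vpath_def)
  then show ?thesis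
  proof (induction P rule: vwalk_induct)
    case (Base x)
    then show ?case using assms(3) by (intro exI[of _ "[x]"]) (auto simp: vpath_def)
  next
    case (Cons a b r)
    then obtain P' where P': "vpath P' (with_proj ?H)" "hd P' = b" "set (b # r) \<subseteq> set P'"
        "set P' \<subseteq> insert w (set (b # r))" "w \<in> set P' \<Longrightarrow> u \<in> set (b # r) \<and> v \<in> set (b # r)"
      by auto
    have ab: "(a, b) \<in> parcs G" using Cons by simp
    then have aw: "a \<noteq> w" "b \<noteq> w" "a \<in> pverts G" using assms(3) by (auto dest: wellformed')
    have a: "a \<notin> set P'" using P' Cons.prems aw by auto
    have P'ne: "P' \<noteq> []" using P' by auto
    show ?case
    proof (cases "(a, b) \<in> {(u, v), (v, u)}")
      case True
      then have wP: "w \<notin> set P'" using P'(5) Cons.prems by auto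
      have "vwalk P' (with_proj ?H)" using P' by (simp add: vpath_def)
      then have "vwalk (w # P') (with_proj ?H)" using True P'(2) by (intro vwalk_consI) auto
      then have "vwalk (a # w # P') (with_proj ?H)" using True aw uv
        by (subst vwalk_Cons_Cons_iff) auto
      then have "vpath (a # w # P') (with_proj ?H)" using P' wP aw a by (auto simp: vpath_def)
      then show ?thesis using P' True by (intro exI[of _ "a # w # P'"]) auto
    next
      case False
      then have "(a, b) \<in> parcs ?H" using ab by auto
      then have "vwalk (a # P') (with_proj ?H)"
        using P' aw by (intro vwalk_consI) (auto simp: vpath_def)
      then have "vpath (a # P') (with_proj ?H)" using P' a by (auto simp: vpath_def)
      then show ?thesis using P' aw by (intro exI[of _ "a # P'"]) auto
    qed
  qed
qed

lemma subdivide_spine: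
  assumes G: "pair_graph G" "(u, v) \<in> parcs G" "w \<notin> pverts G" and P: "heavy_ended_spine G P"
  shows "\<exists>P'. heavy_ended_spine (subdivide G (u, v) w) P'"
proof -
  have vp: "vpath P (with_proj G)" using P by (simp add: heavy_ended_spine_def)
  then have hdV: "hd P \<in> pverts G" by (auto simp: vpath_def vwalk_def)
  obtain P' where P': "vpath P' (with_proj (subdivide G (u, v) w))" "hd P' = hd P" "set P \<subseteq> set P'"
    using subdivide_vpath[OF G vp] by blast
  have "heavy_ended_spine (subdivide G (u, v) w) P'"
    using P P' hdV subdivide_deg[OF G] unfolding heavy_ended_spine_def subdivide_leaves[OF G]
    by auto
  then show ?thesis ..
qed

lemma subdivision_spine:
  assumes "subdivision_pair G H" "pair_graph G" "\<exists>P. heavy_ended_spine G P"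
  shows "\<exists>P. heavy_ended_spine H P"
  using assms(1)
proof (induction H rule: subdivision_pair_induct)
  case base
  then show ?case using assms(3) by blast
next
  case (divide e w H)
  have "pair_graph H" using pair_graph.pair_graph_subdivision[OF assms(2)] divide by blast
  then show ?case using subdivide_spine[of H "fst e" "snd e" w] divide by auto
qed

section \<open>Caterpillars\<close>

lemma caterpillar_parcs:
  "((i, j), (i', j')) \<in> parcs (caterpillar ts) \<longleftrightarrow> i < length ts \<and> i' < length ts \<and>
    (j = 0 \<and> j' = 0 \<and> (i' = Suc i \<or> i = Suc i') \<or>
     i = i' \<and> (j = 0 \<and> 1 \<le> j' \<and> j' \<le> ts ! i \<or> j' = 0 \<and> 1 \<le> j \<and> j \<le> ts ! i))"
  by (auto simp: caterpillar_def Let_def)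

lemma caterpillar_pverts: "(i, j) \<in> pverts (caterpillar ts) \<longleftrightarrow> i < length ts \<and> j \<le> ts ! i"
  by (auto simp: caterpillar_def)

lemma caterpillar_spine:
  assumes "2 \<le> length ts" "1 \<le> hd ts" "sum_list (butlast ts) \<le> last ts"
  shows "\<exists>P. heavy_ended_spine (caterpillar ts) P"
proof -
  let ?G = "caterpillar ts" and ?k = "length ts"
  interpret G: pair_graph ?G by (rule pair_graph_caterpillar)
  have ts: "ts \<noteq> []" using assms(1) by auto
  have t0: "1 \<le> ts ! 0" using assms(2) ts by (simp add: hd_conv_nth)
  have "hd ts \<in> set (butlast ts)" using assms(1) by (cases ts) auto
  then have "hd ts \<le> sum_list (butlast ts)" by (intro member_le_sum_list) auto
  then have tk: "1 \<le> last ts" using assms(2,3) by linarith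
  have last: "last ts = ts ! (?k - 1)" using ts by (rule last_conv_nth)
  have fin: "finite (nbrs ?G x)" for x
  proof -
    have "nbrs ?G x \<subseteq> pverts ?G" by (auto simp: nbrs_def dest: G.wellformed')
    then show ?thesis using G.pair_finite_verts finite_subset by blast
  qed
  have two: "2 \<le> deg ?G x" if "a \<in> nbrs ?G x" "b \<in> nbrs ?G x" "a \<noteq> b" for x a b
    using card_mono[OF fin, of "{a, b}" x] that by (simp add: deg_eq_card_nbrs)
  have spine_deg: "2 \<le> deg ?G (i, 0)" if i: "i < ?k" for i
  proof -
    consider "i = 0" | "i = ?k - 1" "0 < i" | "0 < i" "Suc i < ?k" using i by linarith
    then show ?thesis
    proof cases
      case 1
      then show ?thesis using assms(1) t0
        by (intro two[of "(1, 0)" _ "(0, 1)"]) (auto simp: nbrs_def caterpillar_parcs)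
    next
      case 2
      then show ?thesis using assms(1) tk last
        by (intro two[of "(i - 1, 0)" _ "(i, 1)"]) (auto simp: nbrs_def caterpillar_parcs)
    next
      case 3
      then show ?thesis
        by (intro two[of "(i - 1, 0)" _ "(Suc i, 0)"]) (auto simp: nbrs_def caterpillar_parcs)
    qed
  qed
  have leaf_deg: "deg ?G (i, j) = 1" if "i < ?k" "1 \<le> j" "j \<le> ts ! i" for i j
  proof -
    have "nbrs ?G (i, j) = {(i, 0)}" using that by (auto simp: nbrs_def caterpillar_parcs)
    then show ?thesis by (simp add: deg_eq_card_nbrs)
  qed
  have "leaves ?G \<subseteq> Sigma {..<?k} (\<lambda>i. {1..ts ! i})"
  proof
    fix x assume x: "x \<in> leaves ?G"
    obtain i j where ij: "x = (i, j)" by (cases x)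
    then have "i < ?k" "j \<le> ts ! i" "deg ?G (i, j) = 1"
      using x by (auto simp: leaves_def caterpillar_pverts)
    moreover have "j \<noteq> 0" using spine_deg[of i] calculation by (cases "j = 0") auto
    ultimately show "x \<in> Sigma {..<?k} (\<lambda>i. {1..ts ! i})" using ij by auto
  qed
  then have "card (leaves ?G) \<le> card (Sigma {..<?k} (\<lambda>i. {1..ts ! i}))"
    by (intro card_mono) auto
  also have "\<dots> = (\<Sum>i<?k. ts ! i)" by simp
  also have "\<dots> = sum_list ts" by (simp add: sum_list_sum_nth atLeast0LessThan)
  also have "\<dots> = sum_list (butlast ts) + last ts"
    using ts by (metis append_butlast_last_id sum_list_append sum_list.Cons sum_list.Nil add_0_right)
  finally have few: "card (leaves ?G) \<le> 2 * last ts" using assms(3) by linarith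
  let ?z = "(?k - 1, 0::nat)"
  have "insert (?k - 2, 0) (Pair (?k - 1) ` {1..last ts}) \<subseteq> nbrs ?G ?z"
    using assms(1) last by (auto simp: nbrs_def caterpillar_parcs)
  then have "card (insert (?k - 2, 0) (Pair (?k - 1) ` {1..last ts})) \<le> deg ?G ?z"
    unfolding deg_eq_card_nbrs by (intro card_mono fin)
  moreover have "card (insert (?k - 2, 0) (Pair (?k - 1) ` {1..last ts})) = last ts + 1"
    by (subst card_insert_disjoint) (auto simp: card_image inj_on_def)
  ultimately have heavy: "card (leaves ?G) + 2 \<le> 2 * deg ?G ?z" using few by linarith
  let ?P = "map (\<lambda>i. (i, 0::nat)) (rev [0..<?k])"
  have "vwalk (map (\<lambda>i. (i, 0)) (rev [0..<n])) (with_proj ?G)" if "0 < n" "n \<le> ?k" for n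
    using that
  proof (induction n)
    case (Suc n)
    show ?case
    proof (cases "n = 0")
      case True
      then show ?thesis using Suc.prems by (auto simp: caterpillar_pverts)
    next
      case False
      let ?Q = "map (\<lambda>i. (i, 0::nat)) (rev [0..<n])"
      have "hd ?Q = (n - 1, 0)" using False by (cases n) auto
      then have "((n, 0), hd ?Q) \<in> parcs ?G" using False Suc.prems by (auto simp: caterpillar_parcs)
      moreover have "vwalk ?Q (with_proj ?G)" using Suc False by auto
      ultimately have "vwalk ((n, 0) # ?Q) (with_proj ?G)"
        using Suc.prems by (intro vwalk_consI) (auto simp: caterpillar_pverts)
      then show ?thesis by simp
    qed
  qed simp
  from this[of ?k] have "vwalk ?P (with_proj ?G)" using ts by simp
  then have "vpath ?P (with_proj ?G)" by (auto simp: vpath_def distinct_map inj_on_def)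
  moreover have "hd ?P = ?z" using ts by (cases ?k) auto
  moreover have "x \<in> set ?P" if x: "x \<in> pverts ?G" "3 \<le> deg ?G x" for x
  proof -
    obtain i j where ij: "x = (i, j)" by (cases x)
    then have "j = 0" "i < ?k" using x leaf_deg[of i j] by (cases "j = 0"; auto simp: caterpillar_pverts)+
    then show ?thesis using ij by auto
  qed
  ultimately have "heavy_ended_spine ?G ?P" using heavy by (auto simp: heavy_ended_spine_def)
  then show ?thesis ..
qed

section \<open>Trees with a heavy-ended spine are subdivided caterpillars\<close>

lemma set_vwalk_arcs_conv: "set (vwalk_arcs p) = {(p ! i, p ! Suc i) | i. Suc i < length p}"
proof (induction p rule: vwalk_arcs.induct)
  case (3 x y xs)
  have "{((x # y # xs) ! i, (x # y # xs) ! Suc i) | i. Suc i < length (x # y # xs)} =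
    insert (x, y) {((y # xs) ! i, (y # xs) ! Suc i) | i. Suc i < length (y # xs)}"
    (is "?A = ?B")
  proof (intro equalityI subsetI)
    fix e assume "e \<in> ?A"
    then obtain i where i: "e = ((x # y # xs) ! i, (x # y # xs) ! Suc i)" "Suc i < length (x # y # xs)"
      by blast
    then show "e \<in> ?B" by (cases i) auto
  next
    fix e assume "e \<in> ?B"
    then consider "e = (x, y)"
      | i where "e = ((y # xs) ! i, (y # xs) ! Suc i)" "Suc i < length (y # xs)" by blast
    then show "e \<in> ?A"
    proof cases
      case 1
      then show ?thesis by (intro CollectI exI[of _ 0]) auto
    next
      case (2 i)
      then show ?thesis by (intro CollectI exI[of _ "Suc i"]) auto
    qed
  qed
  then show ?case using 3 by simp
qed auto

context tree_graph
begin

text \<open>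
  A third vertex would be joined to each of the two leaves while avoiding the other one, but it must
  lie on one side of the edge.
\<close>

lemma adjacent_leaves:
  assumes "f \<in> leaves T" "g \<in> leaves T" "(f, g) \<in> parcs T" "x \<in> pverts T"
  shows "x = f \<or> x = g"
proof (rule ccontr)
  assume x: "\<not> ?thesis"
  have V: "f \<in> pverts T" "g \<in> pverts T" "f \<noteq> g"
    using assms(3) arcD[of f g] by auto
  have "joined T f g x" "joined T g f x" using joined_leaf assms x V by auto
  then show False using in_beyond_nbr_iff[OF assms(3), of x] assms(4) x by (auto simp: in_beyond_iff)
qed

text \<open>
  Along the path the successor of \<open>Q ! i\<close> reaches the other end of the chord while avoiding \<open>Q ! i\<close>.
\<close>

lemma path_chordless:
  assumes Q: "vpath Q (with_proj T)" and ij: "i < length Q" "j < length Q" "i < j"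
    and e: "(Q ! i, Q ! j) \<in> parcs T"
  shows "j = Suc i"
proof (rule ccontr)
  assume n: "j \<noteq> Suc i"
  have d: "distinct Q" and w: "vwalk Q (with_proj T)" using Q by (auto simp: vpath_def)
  have arc: "(Q ! l, Q ! Suc l) \<in> parcs T" if "Suc l < length Q" for l
    using w that by (auto simp: vwalk_def set_vwalk_arcs_conv)
  have "joined T (Q ! i) (Q ! Suc i) (Q ! l)" if "Suc i \<le> l" "l < length Q" for l
    using that
  proof (induction l rule: dec_induct)
    case base
    then show ?case by (simp add: joined_refl)
  next
    case (step l)
    have "Q ! l \<noteq> Q ! i" "Q ! Suc l \<noteq> Q ! i"
      using d step ij by (auto simp: nth_eq_iff_index_eq)
    then have "joined T (Q ! i) (Q ! l) (Q ! Suc l)" using arc step by (intro joined_arc) auto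
    then show ?case using step joined_trans by auto
  qed
  then have "joined T (Q ! i) (Q ! Suc i) (Q ! j)" using ij by simp
  moreover have "Q ! Suc i \<noteq> Q ! j" using d n ij by (auto simp: nth_eq_iff_index_eq)
  moreover have "(Q ! i, Q ! Suc i) \<in> parcs T" using arc ij by simp
  ultimately show False using separates e by blast
qed

text \<open>
  The \<open>i\<close>-th spine vertex corresponds to \<open>(i, 0)\<close>, and the leaves attached to it are numbered by a
  bijection \<open>g i\<close>.  Here the heavy end is the last vertex of \<open>Q\<close>, as in \<open>caterpillar\<close>.
\<close>

lemma caterpillar_iso:
  assumes Q: "vpath Q (with_proj T)" and len: "2 \<le> length Q"
    and deg_hd: "2 \<le> deg T (hd Q)"
    and heavy: "card (leaves T) + 2 \<le> 2 * deg T (last Q)"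
    and others: "pverts T - set Q \<subseteq> leaves T"
  shows "\<exists>ts \<phi>. 2 \<le> length ts \<and> 1 \<le> hd ts \<and> sum_list (butlast ts) \<le> last ts \<and>
    pair_iso \<phi> (caterpillar ts) T"
proof -
  let ?k = "length Q" and ?L = "leaves T"
  have d: "distinct Q" and w: "vwalk Q (with_proj T)" using Q by (auto simp: vpath_def)
  have QV: "set Q \<subseteq> pverts T" using w by (auto simp: vwalk_def)
  have Qne: "Q \<noteq> []" using len by auto
  have hdV: "hd Q \<in> pverts T" using QV Qne by auto
  have arc: "(Q ! l, Q ! Suc l) \<in> parcs T" if "Suc l < ?k" for l
    using w that by (auto simp: vwalk_def set_vwalk_arcs_conv)
  have adj: "j = Suc i \<or> i = Suc j" if "i < ?k" "j < ?k" "(Q ! i, Q ! j) \<in> parcs T" for i j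
  proof -
    have "i \<noteq> j" using that no_loops' by metis
    then show ?thesis
      using path_chordless[OF Q that(1,2)] path_chordless[OF Q that(2,1)] that arcs_symmetric
      by (metis linorder_neqE_nat)
  qed
  have disj: "x \<notin> ?L" if xQ: "x \<in> set Q" for x
  proof
    assume "x \<in> ?L"
    then have xd: "deg T x = 1" by (simp add: leaves_def)
    obtain i where i: "i < ?k" "x = Q ! i" using xQ by (auto simp: in_set_conv_nth)
    have "card ?L \<noteq> 0" using \<open>x \<in> ?L\<close> finite_leaves by auto
    then have "x \<noteq> hd Q" "x \<noteq> last Q" using xd deg_hd heavy by auto
    then have ends: "i \<noteq> 0" "i \<noteq> ?k - 1"
      using i Qne by (metis hd_conv_nth, metis last_conv_nth)
    then have "{Q ! (i - 1), Q ! Suc i} \<subseteq> nbrs T x"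
      using arc[of i] arc[of "i - 1"] i arcs_symmetric by (auto simp: nbrs_def)
    then have "card {Q ! (i - 1), Q ! Suc i} \<le> deg T x"
      unfolding deg_eq_card_nbrs by (intro card_mono nbrs_finite)
    moreover have "Q ! (i - 1) \<noteq> Q ! Suc i" using d i ends by (auto simp: nth_eq_iff_index_eq)
    ultimately show False using xd by simp
  qed
  have LV: "?L \<subseteq> pverts T" by (auto simp: leaves_def)
  have V: "pverts T = set Q \<union> ?L" using others QV LV by blast
  have nbr_Q: "g \<in> set Q" if "f \<in> ?L" "(f, g) \<in> parcs T" for f g
  proof (rule ccontr)
    assume "g \<notin> set Q"
    then have "g \<in> ?L" using others arcD[OF that(2)] by blast
    then have "hd Q = f \<or> hd Q = g" using adjacent_leaves[OF that(1) _ that(2)] hdV by blast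
    then show False using disj[of "hd Q"] that(1) \<open>g \<in> ?L\<close> Qne by auto
  qed
  have leaf_unique: "g = g'" if "f \<in> ?L" "(g, f) \<in> parcs T" "(g', f) \<in> parcs T" for f g g'
  proof -
    have "card (nbrs T f) = 1" using that(1) by (simp add: leaves_def deg_eq_card_nbrs)
    moreover have "g \<in> nbrs T f" "g' \<in> nbrs T f" using that arcs_symmetric by (auto simp: nbrs_def)
    ultimately show ?thesis by (metis card_1_singletonE singletonD)
  qed
  define A where "A i = nbrs T (Q ! i) \<inter> ?L" for i
  have finA: "finite (A i)" for i by (simp add: A_def finite_leaves)
  define t where "t i = card (A i)" for i
  have "\<exists>g. \<forall>i. bij_betw (g i) {1..t i} (A i)"
    using ex_bij_betw_nat_finite_1[OF finA] unfolding t_def by metis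
  then obtain g where g: "\<And>i. bij_betw (g i) {1..t i} (A i)" by blast
  define ts where "ts = map t [0..<?k]"
  have ts_nth: "ts ! i = t i" if "i < ?k" for i using that by (simp add: ts_def)
  have ts_len: "length ts = ?k" by (simp add: ts_def)
  define \<phi> where "\<phi> = (\<lambda>(i, j). if j = 0 then Q ! i else g i j)"
  have gA: "g i j \<in> A i" if "1 \<le> j" "j \<le> t i" for i j
    using g[of i] that by (auto simp: bij_betw_def)
  have g_L: "g i j \<in> ?L" "(Q ! i, g i j) \<in> parcs T" if "1 \<le> j" "j \<le> t i" for i j
    using gA[OF that] by (auto simp: A_def nbrs_def)
  have g_surj: "\<exists>j. 1 \<le> j \<and> j \<le> t i \<and> f = g i j" if "f \<in> ?L" "(Q ! i, f) \<in> parcs T" for i f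
  proof -
    have "f \<in> g i ` {1..t i}" using g[of i] that by (auto simp: bij_betw_def A_def nbrs_def)
    then show ?thesis by auto
  qed
  have inj: "inj_on \<phi> (pverts (caterpillar ts))"
  proof (rule inj_onI)
    fix x y assume x: "x \<in> pverts (caterpillar ts)" and y: "y \<in> pverts (caterpillar ts)" and eq: "\<phi> x = \<phi> y"
    obtain i j i' j' where ij: "x = (i, j)" "y = (i', j')" by (cases x, cases y)
    have i: "i < ?k" "j \<le> t i" "i' < ?k" "j' \<le> t i'"
      using x y ij by (auto simp: caterpillar_pverts ts_len ts_nth)
    show "x = y"
    proof (cases "j = 0")
      case True
      have "j' = 0"
      proof (rule ccontr)
        assume "j' \<noteq> 0"
        then have "Q ! i \<in> ?L" using eq g_L(1)[of j' i'] i True by (simp add: \<phi>_def ij)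
        then show False using disj i by simp
      qed
      then show ?thesis using eq True d i by (simp add: \<phi>_def ij nth_eq_iff_index_eq)
    next
      case False
      have "j' \<noteq> 0"
      proof
        assume "j' = 0"
        then have "Q ! i' \<in> ?L" using eq g_L(1)[of j i] i False by (simp add: \<phi>_def ij)
        then show False using disj i by simp
      qed
      then have eq': "g i j = g i' j'" using eq False by (simp add: \<phi>_def ij)
      have "Q ! i = Q ! i'"
        using leaf_unique[of "g i j"] g_L[of j i] g_L[of j' i'] eq' i False \<open>j' \<noteq> 0\<close> by simp
      then have "i = i'" using d i by (simp add: nth_eq_iff_index_eq)
      moreover have "j = j'"
        using g[of i] eq' \<open>i = i'\<close> i False \<open>j' \<noteq> 0\<close> by (auto simp: bij_betw_def dest!: inj_onD)
      ultimately show ?thesis by (simp add: ij)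
    qed
  qed
  have verts: "pverts T = \<phi> ` pverts (caterpillar ts)"
  proof (intro equalityI subsetI)
    fix x assume x: "x \<in> pverts T"
    show "x \<in> \<phi> ` pverts (caterpillar ts)"
    proof (cases "x \<in> set Q")
      case True
      then obtain i where "i < ?k" "x = Q ! i" by (auto simp: in_set_conv_nth)
      then show ?thesis
        by (intro image_eqI[of _ _ "(i, 0)"]) (auto simp: \<phi>_def caterpillar_pverts ts_len)
    next
      case False
      then have xL: "x \<in> ?L" using x V by blast
      then have "card (nbrs T x) = 1" by (simp add: leaves_def deg_eq_card_nbrs)
      then obtain q where "(x, q) \<in> parcs T" by (auto simp: nbrs_def card_1_singleton_iff)
      moreover then obtain i where "i < ?k" "q = Q ! i"
        using nbr_Q[OF xL] by (auto simp: in_set_conv_nth)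
      ultimately obtain j where "i < ?k" "1 \<le> j" "j \<le> t i" "x = g i j"
        using g_surj[OF xL, of i] arcs_symmetric by blast
      then show ?thesis
        by (intro image_eqI[of _ _ "(i, j)"]) (auto simp: \<phi>_def caterpillar_pverts ts_len ts_nth)
    qed
  next
    fix x assume "x \<in> \<phi> ` pverts (caterpillar ts)"
    then obtain i j where "i < ?k" "j \<le> t i" "x = \<phi> (i, j)"
      by (auto simp: caterpillar_pverts ts_len ts_nth)
    then show "x \<in> pverts T" using QV LV g_L(1)[of j i] by (cases "j = 0") (auto simp: \<phi>_def)
  qed
  have arcs: "parcs T = map_prod \<phi> \<phi> ` parcs (caterpillar ts)"
  proof (intro equalityI subsetI)
    fix e assume e: "e \<in> parcs T"
    obtain a b where ab: "e = (a, b)" by (cases e)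
    have abV: "a \<in> set Q \<union> ?L" "b \<in> set Q \<union> ?L" using e ab V arcD[of a b] by auto
    have leaf_arc: "\<exists>i j. i < ?k \<and> 1 \<le> j \<and> j \<le> t i \<and> q = Q ! i \<and> f = g i j"
      if "q \<in> set Q" "f \<in> ?L" "(q, f) \<in> parcs T" for q f
      using that g_surj by (metis in_set_conv_nth)
    consider (QQ) "a \<in> set Q" "b \<in> set Q" | (QL) "a \<in> set Q" "b \<in> ?L" | (LQ) "a \<in> ?L" "b \<in> set Q"
      using abV nbr_Q e ab by blast
    then show "e \<in> map_prod \<phi> \<phi> ` parcs (caterpillar ts)"
    proof cases
      case QQ
      then obtain i j where "i < ?k" "a = Q ! i" "j < ?k" "b = Q ! j" by (auto simp: in_set_conv_nth)
      then show ?thesis using adj[of i j] e ab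
        by (intro image_eqI[of _ _ "((i, 0), (j, 0))"]) (auto simp: \<phi>_def caterpillar_parcs ts_len)
    next
      case QL
      then obtain i j where "i < ?k" "1 \<le> j" "j \<le> t i" "a = Q ! i" "b = g i j"
        using leaf_arc[of a b] e ab by blast
      then show ?thesis using ab
        by (intro image_eqI[of _ _ "((i, 0), (i, j))"])
          (auto simp: \<phi>_def caterpillar_parcs ts_len ts_nth)
    next
      case LQ
      then obtain i j where "i < ?k" "1 \<le> j" "j \<le> t i" "b = Q ! i" "a = g i j"
        using leaf_arc[of b a] e ab arcs_symmetric by blast
      then show ?thesis using ab
        by (intro image_eqI[of _ _ "((i, j), (i, 0))"])
          (auto simp: \<phi>_def caterpillar_parcs ts_len ts_nth)
    qed
  next
    fix e assume "e \<in> map_prod \<phi> \<phi> ` parcs (caterpillar ts)"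
    then obtain i j i' j' where e: "e = (\<phi> (i, j), \<phi> (i', j'))"
      and c: "((i, j), (i', j')) \<in> parcs (caterpillar ts)" by auto
    show "e \<in> parcs T"
      using c arc[of i] arc[of i'] g_L(2)[of j i] g_L(2)[of j' i] arcs_symmetric
      by (auto simp: e caterpillar_parcs \<phi>_def ts_len ts_nth)
  qed
  have "1 \<le> t 0"
  proof -
    have "nbrs T (hd Q) \<subseteq> insert (Q ! 1) (A 0)"
    proof
      fix x assume x: "x \<in> nbrs T (hd Q)"
      then have x0: "(Q ! 0, x) \<in> parcs T" using Qne by (simp add: nbrs_def hd_conv_nth)
      show "x \<in> insert (Q ! 1) (A 0)"
      proof (cases "x \<in> set Q")
        case True
        then obtain i where "i < ?k" "x = Q ! i" by (auto simp: in_set_conv_nth)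
        then show ?thesis using adj[of 0 i] x0 Qne by auto
      next
        case False
        then show ?thesis using x0 V arcD(2)[OF x0] by (auto simp: A_def nbrs_def)
      qed
    qed
    then have "deg T (hd Q) \<le> card (insert (Q ! 1) (A 0))"
      unfolding deg_eq_card_nbrs using finA by (intro card_mono) auto
    also have "\<dots> \<le> Suc (t 0)" unfolding t_def using finA by (intro card_insert_le_m1) auto
    finally show ?thesis using deg_hd by simp
  qed
  have tk: "deg T (last Q) \<le> Suc (t (?k - 1))"
  proof -
    have "nbrs T (last Q) \<subseteq> insert (Q ! (?k - 2)) (A (?k - 1))"
    proof
      fix x assume x: "x \<in> nbrs T (last Q)"
      then have x0: "(Q ! (?k - 1), x) \<in> parcs T" using Qne by (simp add: nbrs_def last_conv_nth)
      show "x \<in> insert (Q ! (?k - 2)) (A (?k - 1))"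
      proof (cases "x \<in> set Q")
        case True
        then obtain i where i: "i < ?k" "x = Q ! i" by (auto simp: in_set_conv_nth)
        moreover have "?k - 1 < ?k" using len by linarith
        ultimately have "i = Suc (?k - 1) \<or> ?k - 1 = Suc i" using adj x0 by blast
        then have "i = ?k - 2" using i len by linarith
        then show ?thesis using i by simp
      next
        case False
        then show ?thesis using x0 V arcD(2)[OF x0] by (auto simp: A_def nbrs_def)
      qed
    qed
    then have "deg T (last Q) \<le> card (insert (Q ! (?k - 2)) (A (?k - 1)))"
      unfolding deg_eq_card_nbrs using finA by (intro card_mono) auto
    also have "\<dots> \<le> Suc (t (?k - 1))" unfolding t_def using finA by (intro card_insert_le_m1) auto
    finally show ?thesis .
  qed
  have "sum_list ts = (\<Sum>i<?k. t i)"
    by (simp add: ts_def sum_list_sum_nth atLeast0LessThan)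
  also have "\<dots> = card (\<Union>i<?k. A i)"
    unfolding t_def
  proof (intro card_UN_disjoint[symmetric] ballI impI)
    fix i j assume ij: "i \<in> {..<?k}" "j \<in> {..<?k}" "i \<noteq> j"
    then have "Q ! i \<noteq> Q ! j" using d by (simp add: nth_eq_iff_index_eq)
    then show "A i \<inter> A j = {}" using leaf_unique by (auto simp: A_def nbrs_def)
  qed (use finA in auto)
  also have "\<dots> \<le> card ?L" by (intro card_mono finite_leaves) (auto simp: A_def)
  finally have sum: "sum_list ts \<le> card ?L" .
  have ts_ne: "ts \<noteq> []" using Qne ts_len by auto
  then have "hd ts = t 0" "last ts = t (?k - 1)"
    using ts_nth[of 0] ts_nth[of "?k - 1"] Qne ts_len by (auto simp: hd_conv_nth last_conv_nth)
  moreover have "sum_list ts = sum_list (butlast ts) + last ts"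
    using ts_ne by (metis append_butlast_last_id sum_list_append sum_list.Cons sum_list.Nil add_0_right)
  ultimately have "1 \<le> hd ts" "sum_list (butlast ts) \<le> last ts"
    using \<open>1 \<le> t 0\<close> tk sum heavy by linarith+
  moreover have "pair_iso \<phi> (caterpillar ts) T" using inj verts arcs by (simp add: pair_iso_def)
  ultimately show ?thesis using len ts_len by metis
qed

end

subsection \<open>Suppressing a vertex of degree two\<close>

text \<open>
  The inverse of \<open>subdivide\<close> at a vertex \<open>w\<close> of degree 2 with neighbours \<open>u\<close> and \<open>v\<close>.
\<close>

definition suppress :: "'a pair_pre_digraph \<Rightarrow> 'a \<Rightarrow> 'a \<Rightarrow> 'a \<Rightarrow> 'a pair_pre_digraph" where
  "suppress G u w v = \<lparr> pverts = pverts G - {w},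
     parcs = parcs G - {(u, w), (w, u), (v, w), (w, v)} \<union> {(u, v), (v, u)} \<rparr>"

context tree_graph
begin

text \<open>
  Since \<open>w\<close> separates \<open>u\<close> from \<open>v\<close>, these are not adjacent, so the new edge really is new.  A step
  along the new edge can be replaced by two steps through \<open>w\<close>; this transfers the tree axioms.
\<close>

lemma
  assumes w: "nbrs T w = {u, v}" "u \<noteq> v"
  shows suppress_arc: "(u, v) \<in> parcs (suppress T u w v)"
    and suppress_fresh: "w \<notin> pverts (suppress T u w v)"
    and subdivide_suppress: "subdivide (suppress T u w v) (u, v) w = T"
    and tree_graph_suppress: "tree_graph (suppress T u w v)"
    and suppress_vwalk: "vwalk p (with_proj T) \<Longrightarrow> distinct p \<Longrightarrow> hd p \<noteq> w \<Longrightarrow> last p \<noteq> w \<Longrightarrow>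
      vwalk (filter (\<lambda>x. x \<noteq> w) p) (with_proj (suppress T u w v))"
proof -
  let ?S = "suppress T u w v"
  have nb: "(w, x) \<in> parcs T \<longleftrightarrow> x = u \<or> x = v" for x using w by (auto simp: nbrs_def)
  then have nb': "(x, w) \<in> parcs T \<longleftrightarrow> x = u \<or> x = v" for x using arcs_symmetric by blast
  have uw: "(w, u) \<in> parcs T" "(w, v) \<in> parcs T" using nb by auto
  have V: "w \<in> pverts T" "u \<in> pverts T" "v \<in> pverts T" "u \<noteq> w" "v \<noteq> w"
    using arcD[OF uw(1)] arcD[OF uw(2)] by auto
  have uv: "(u, v) \<notin> parcs T" using separates[OF uw w(2)] joined_arc[of u v w] V by blast
  then have vu: "(v, u) \<notin> parcs T" using arcs_symmetric by blast
  show arc: "(u, v) \<in> parcs ?S" and fresh: "w \<notin> pverts ?S" by (auto simp: suppress_def)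
  have S_arc: "(a, b) \<in> parcs ?S \<longleftrightarrow>
      a \<noteq> w \<and> b \<noteq> w \<and> ((a, b) \<in> parcs T \<or> (a, b) = (u, v) \<or> (a, b) = (v, u))" for a b
    using nb nb' V by (auto simp: suppress_def)
  have S_verts: "pverts ?S = pverts T - {w}" by (simp add: suppress_def)
  show "subdivide ?S (u, v) w = T"
  proof -
    have "parcs (subdivide ?S (u, v) w) = parcs T"
      using uv vu uw arcs_symmetric by (auto simp: suppress_def)
    moreover have "pverts (subdivide ?S (u, v) w) = pverts T" using V by (auto simp: S_verts)
    ultimately show ?thesis by (simp add: pair_pre_digraph.equality)
  qed
  have "pair_graph ?S"
  proof
    fix e assume "e \<in> parcs ?S"
    then show "fst e \<in> pverts ?S" "snd e \<in> pverts ?S" "fst e \<noteq> snd e"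
      using V w(2) arcD[of "fst e" "snd e"] by (cases e; auto simp: S_arc S_verts)+
  next
    show "finite (pverts ?S)" using pair_finite_verts by (simp add: S_verts)
    show "finite (parcs ?S)" using pair_finite_arcs by (simp add: suppress_def)
    show "symmetric ?S" unfolding symmetric_def with_proj_simps
      using arcs_symmetric by (intro symI) (auto simp: S_arc)
  qed
  then interpret S: pair_graph ?S .
  have S_joined: "joined T m a b" if "m \<noteq> w" "joined ?S m a b" for m a b
    using that(2) unfolding joined_def[of ?S]
  proof induction
    case base
    then show ?case by (rule joined_refl)
  next
    case (step b c)
    have "joined T m b c"
    proof (cases "(b, c) \<in> parcs T")
      case True
      then show ?thesis using step by (intro joined_arc) auto
    next
      case False
      then have "joined T m b w" "joined T m w c"
        using step that(1) uw arcs_symmetric by (auto simp: S_arc intro!: joined_arc)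
      then show ?thesis by (rule joined_trans)
    qed
    then show ?case using step joined_trans by blast
  qed
  show "tree_graph ?S"
  proof unfold_locales
    fix a c assume a: "a \<in> pverts ?S" and c: "c \<in> pverts ?S"
    have "(x \<noteq> w \<longrightarrow> (a, x) \<in> (parcs ?S)\<^sup>*) \<and> (x = w \<longrightarrow> (a, u) \<in> (parcs ?S)\<^sup>*)"
      if "(a, x) \<in> (parcs T)\<^sup>*" for x
      using that
    proof induction
      case base
      then show ?case using a by (auto simp: S_verts)
    next
      case (step x y)
      show ?case
      proof (cases "x = w")
        case True
        then have "y = u \<or> y = v" using step nb by blast
        then show ?thesis using step True arc V by (auto intro: rtrancl_into_rtrancl)
      next
        case False
        then have ax: "(a, x) \<in> (parcs ?S)\<^sup>*" using step by blast
        show ?thesis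
        proof (cases "y = w")
          case True
          then have "x = u \<or> x = v" using step nb' by blast
          then have "x = u \<or> (x, u) \<in> parcs ?S" using arc S.arcs_symmetric by blast
          then show ?thesis using ax True by (auto intro: rtrancl_into_rtrancl)
        next
          case neq: False
          then have "(x, y) \<in> parcs ?S" using step False by (auto simp: S_arc)
          then show ?thesis using ax neq by (auto intro: rtrancl_into_rtrancl)
        qed
      qed
    qed
    from this[of c] show "(a, c) \<in> (parcs ?S)\<^sup>*" using linked a c by (auto simp: S_verts)
  next
    fix m x y assume x: "(m, x) \<in> parcs ?S" and y: "(m, y) \<in> parcs ?S" and xy: "x \<noteq> y"
    have m: "m \<noteq> w" using x by (simp add: S_arc)
    \<comment> \<open>A neighbour in the suppressed tree comes from a neighbour in \<open>T\<close> on the same side.\<close>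
    have lift: "\<exists>z. (m, z) \<in> parcs T \<and> joined T m z x \<and> (z = x \<or> z = w \<and> {m, x} = {u, v})"
      if e: "(m, x) \<in> parcs ?S" for x
    proof (cases "(m, x) \<in> parcs T")
      case True
      then show ?thesis using joined_refl by blast
    next
      case False
      then have mx: "{m, x} = {u, v}" using e by (auto simp: S_arc)
      then have "(m, w) \<in> parcs T" "(w, x) \<in> parcs T" using nb nb' by (auto simp: doubleton_eq_iff)
      moreover have "x \<noteq> m" using mx w(2) by (auto simp: doubleton_eq_iff)
      ultimately have "joined T m w x" using m by (intro joined_arc) auto
      then show ?thesis using mx \<open>(m, w) \<in> parcs T\<close> by blast
    qed
    obtain x' where x': "(m, x') \<in> parcs T" "joined T m x' x" "x' = x \<or> x' = w \<and> {m, x} = {u, v}"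
      using lift[OF x] by blast
    obtain y' where y': "(m, y') \<in> parcs T" "joined T m y' y" "y' = y \<or> y' = w \<and> {m, y} = {u, v}"
      using lift[OF y] by blast
    have "x' \<noteq> y'"
    proof
      assume "x' = y'"
      moreover have "x \<noteq> w" "y \<noteq> w" using x y by (auto simp: S_arc)
      ultimately have "{m, x} = {m, y}" using x'(3) y'(3) xy by auto
      then show False using xy by (auto simp: doubleton_eq_iff)
    qed
    then have "\<not> joined T m x' y'" using separates x' y' by blast
    then show "\<not> joined ?S m x y"
      using S_joined[OF m] x'(2) y'(2) joined_trans joined_sym by blast
  qed
  show "vwalk (filter (\<lambda>x. x \<noteq> w) p) (with_proj ?S)"
    if p: "vwalk p (with_proj T)" "distinct p" "hd p \<noteq> w" "last p \<noteq> w"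
  proof -
    have keep: "vwalk q (with_proj ?S)" if "vwalk q (with_proj T)" "w \<notin> set q" for q
      using that unfolding vwalk_def S_verts with_proj_simps
      by (auto simp: S_arc subset_iff dest: in_set_vwalk_arcsE elim!: in_set_vwalk_arcsE)
    show ?thesis
    proof (cases "w \<in> set p")
      case False
      then have "filter (\<lambda>x. x \<noteq> w) p = p" by (auto simp: filter_id_conv)
      then show ?thesis using keep p False by simp
    next
      case True
      then obtain p1 p2 where pe: "p = p1 @ w # p2" by (auto dest: split_list)
      have ne: "p1 \<noteq> []" "p2 \<noteq> []" using pe p by auto
      have nw: "w \<notin> set p1" "w \<notin> set p2" using pe p by auto
      have w1: "vwalk p1 (with_proj T)" using vwalkI_append_l ne p pe by blast
      have w2: "vwalk (w # p2) (with_proj T)" using vwalkI_append_r[of "w # p2" p1] p pe by simp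
      then have w2': "vwalk p2 (with_proj T)" "(w, hd p2) \<in> parcs T"
        using ne by (auto elim: vwalk_consE)
      have "(last p1, w) \<in> set (vwalk_arcs p)" using pe ne by (simp add: vwalk_arcs_append)
      then have "(last p1, w) \<in> parcs T" using p by (auto simp: vwalk_def)
      moreover have "last p1 \<noteq> hd p2"
      proof -
        have "last p1 \<in> set p1" "hd p2 \<in> set p2" using ne by simp_all
        then show ?thesis using p(2) pe by auto
      qed
      ultimately have "(last p1, hd p2) \<in> parcs ?S" using nb nb' w2'(2) V by (auto simp: S_arc)
      moreover have "vwalk p1 (with_proj ?S)" "vwalk p2 (with_proj ?S)"
        using keep w1 w2' nw by auto
      ultimately have "vwalk (p1 @ p2) (with_proj ?S)"
        using ne by (auto simp: vwalk_def vwalk_arcs_append)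
      moreover have "filter (\<lambda>x. x \<noteq> w) p = p1 @ p2"
      proof -
        have "filter (\<lambda>x. x \<noteq> w) p1 = p1" "filter (\<lambda>x. x \<noteq> w) p2 = p2"
          using nw by (auto simp: filter_id_conv)
        then show ?thesis using pe by simp
      qed
      ultimately show ?thesis by simp
    qed
  qed
qed

end

lemma pair_iso_subdivide:
  assumes iso: "pair_iso \<phi> G H" and G: "pair_wf_digraph G" and e: "(u, v) \<in> parcs G"
    and w: "w \<notin> pverts G" "w' \<notin> pverts H"
  shows "pair_iso (\<phi>(w := w')) (subdivide G (u, v) w) (subdivide H (\<phi> u, \<phi> v) w')"
proof -
  interpret pair_wf_digraph G by fact
  let ?\<psi> = "\<phi>(w := w')"
  have inj: "inj_on \<phi> (pverts G)" and V: "pverts H = \<phi> ` pverts G"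
    and A: "parcs H = map_prod \<phi> \<phi> ` parcs G" using iso by (auto simp: pair_iso_def)
  have uv: "u \<in> pverts G" "v \<in> pverts G" "u \<noteq> w" "v \<noteq> w" using e w by (auto dest: wellformed')
  have sub: "parcs G \<subseteq> pverts G \<times> pverts G" by (auto dest: wellformed')
  have eq: "map_prod ?\<psi> ?\<psi> x = map_prod \<phi> \<phi> x" if "x \<in> pverts G \<times> pverts G" for x
    using that w by (cases x) auto
  have "inj_on (map_prod \<phi> \<phi>) (pverts G \<times> pverts G)"
    using inj by (rule map_prod_inj_on[OF inj])
  then have "map_prod \<phi> \<phi> ` (parcs G - {(u, v), (v, u)}) =
      map_prod \<phi> \<phi> ` parcs G - map_prod \<phi> \<phi> ` {(u, v), (v, u)}"
    using sub uv by (intro inj_on_image_set_diff) auto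
  moreover have "map_prod ?\<psi> ?\<psi> ` (parcs G - {(u, v), (v, u)}) =
      map_prod \<phi> \<phi> ` (parcs G - {(u, v), (v, u)})"
    using eq sub by (intro image_cong) auto
  ultimately have "parcs (subdivide H (\<phi> u, \<phi> v) w') = map_prod ?\<psi> ?\<psi> ` parcs (subdivide G (u, v) w)"
    using uv by (simp add: A image_Un)
  moreover have "pverts (subdivide H (\<phi> u, \<phi> v) w') = ?\<psi> ` pverts (subdivide G (u, v) w)"
    using w V by (auto simp: image_iff)
  moreover have "inj_on ?\<psi> (pverts (subdivide G (u, v) w))"
    using inj w V by (auto simp: inj_on_def)
  ultimately show ?thesis by (simp add: pair_iso_def)
qed

text \<open>
  Induction on the order.  A vertex of degree 2 other than the two ends of the spine is suppressed,
  and the subdivision obtained for the smaller tree is subdivided once more; the new vertex exists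
  because there are infinitely many pairs of natural numbers.  If there is no such vertex, everything
  outside the spine is a leaf.  The ends are kept, because both of them have to carry leaves.
\<close>

lemma subdivided_caterpillar_if_spine:
  fixes T :: "'a pair_pre_digraph"
  assumes "tree_graph T" "vpath Q (with_proj T)" "2 \<le> length Q" "2 \<le> deg T (hd Q)"
    "card (leaves T) + 2 \<le> 2 * deg T (last Q)"
    "\<And>x. x \<in> pverts T \<Longrightarrow> 3 \<le> deg T x \<Longrightarrow> x \<in> set Q"
  shows "\<exists>ts H \<phi>. 2 \<le> length ts \<and> 1 \<le> hd ts \<and> sum_list (butlast ts) \<le> last ts \<and>
    subdivision_pair (caterpillar ts) H \<and> pair_iso \<phi> H T"
  using assms
proof (induction "card (pverts T)" arbitrary: T Q rule: less_induct)
  case less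
  interpret tree_graph T by fact
  have wQ: "vwalk Q (with_proj T)" "distinct Q" using less.prems by (auto simp: vpath_def)
  have Qne: "Q \<noteq> []" using less.prems(3) by auto
  have QV: "set Q \<subseteq> pverts T" using wQ by (auto simp: vwalk_def)
  have hl: "hd Q \<noteq> last Q"
    using wQ(2) less.prems(3) Qne by (simp add: hd_conv_nth last_conv_nth nth_eq_iff_index_eq)
  show ?case
  proof (cases "\<exists>w \<in> pverts T. w \<noteq> hd Q \<and> w \<noteq> last Q \<and> deg T w = 2")
    case False
    have "pverts T - set Q \<subseteq> leaves T"
    proof
      fix x assume x: "x \<in> pverts T - set Q"
      then have "deg T x \<noteq> 2" "\<not> 3 \<le> deg T x" using False less.prems(6) Qne by auto
      moreover have "deg T x \<noteq> 0"
      proof -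
        have "hd Q \<in> pverts T" "hd Q \<noteq> x" using x QV Qne by auto
        then obtain y where "y \<in> nbrs T x" using ex_nbr_toward[of x "hd Q"] x by (auto simp: nbrs_def)
        then show ?thesis using nbrs_finite by (auto simp: deg_eq_card_nbrs)
      qed
      ultimately have "deg T x = 1" by linarith
      then show "x \<in> leaves T" using x by (simp add: leaves_def)
    qed
    then obtain ts \<phi> where ts: "2 \<le> length ts" "1 \<le> hd ts" "sum_list (butlast ts) \<le> last ts"
        "pair_iso \<phi> (caterpillar ts) T"
      using caterpillar_iso[of Q] less.prems by blast
    interpret C: pair_graph "caterpillar ts" by (rule pair_graph_caterpillar)
    have "subdivision_pair (caterpillar ts) (caterpillar ts)"
      by (rule subdivision_pair_base) unfold_locales
    then show ?thesis using ts by blast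
  next
    case True
    then obtain w where w: "w \<in> pverts T" "w \<noteq> hd Q" "w \<noteq> last Q" "card (nbrs T w) = 2"
      by (auto simp: deg_eq_card_nbrs)
    then obtain u v where uv: "nbrs T w = {u, v}" "u \<noteq> v" by (auto simp: card_2_iff)
    let ?S = "suppress T u w v" and ?P = "filter (\<lambda>x. x \<noteq> w) Q"
    interpret S: tree_graph ?S using tree_graph_suppress[OF uv] .
    note S = S.pair_graph suppress_arc[OF uv] suppress_fresh[OF uv]
    have V: "pverts ?S = pverts T - {w}" by (simp add: suppress_def)
    have deg: "deg ?S x = deg T x" if "x \<in> pverts T" "x \<noteq> w" for x
      using subdivide_deg(2)[OF S, of x] that unfolding subdivide_suppress[OF uv] V by simp
    have lv: "leaves ?S = leaves T"
      using subdivide_leaves[OF S] unfolding subdivide_suppress[OF uv] by simp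
    have "hd ?P = hd Q" using w Qne by (cases Q) auto
    moreover have "last ?P = last Q" using w Qne by (cases Q rule: rev_cases) auto
    ultimately have ends: "hd ?P = hd Q" "last ?P = last Q" .
    have "hd Q \<in> set ?P" "last Q \<in> set ?P" using w Qne by auto
    then have "card {hd Q, last Q} \<le> card (set ?P)" by (intro card_mono) auto
    then have Plen: "2 \<le> length ?P" using hl card_length[of ?P] by simp
    have "\<exists>ts H \<phi>. 2 \<le> length ts \<and> 1 \<le> hd ts \<and> sum_list (butlast ts) \<le> last ts \<and>
        subdivision_pair (caterpillar ts) H \<and> pair_iso \<phi> H ?S"
    proof (rule less.hyps[of ?S ?P])
      show "card (pverts ?S) < card (pverts T)"
        unfolding V using w(1) pair_finite_verts by (intro psubset_card_mono) auto
      show "tree_graph ?S" by unfold_locales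
      show "vpath ?P (with_proj ?S)"
        using suppress_vwalk[OF uv wQ] w wQ by (simp add: vpath_def)
      show "2 \<le> length ?P" by (rule Plen)
      have hV: "hd Q \<in> pverts T" "last Q \<in> pverts T" using QV Qne by auto
      show "2 \<le> deg ?S (hd ?P)" using less.prems(4) deg hV w by (simp add: ends)
      show "card (leaves ?S) + 2 \<le> 2 * deg ?S (last ?P)"
        using less.prems(5) deg hV w by (simp add: ends lv)
      show "x \<in> set ?P" if "x \<in> pverts ?S" "3 \<le> deg ?S x" for x
        using that less.prems(6)[of x] deg[of x] by (auto simp: V)
    qed
    then obtain ts H \<phi> where ts: "2 \<le> length ts" "1 \<le> hd ts" "sum_list (butlast ts) \<le> last ts"
      and H: "subdivision_pair (caterpillar ts) H" and \<phi>: "pair_iso \<phi> H ?S" by blast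
    interpret H: pair_graph H
      using pair_graph.pair_graph_subdivision[OF pair_graph_caterpillar H] .
    have "(u, v) \<in> map_prod \<phi> \<phi> ` parcs H" using \<phi> S(2) by (simp add: pair_iso_def)
    then obtain u' v' where e: "(u', v') \<in> parcs H" "u = \<phi> u'" "v = \<phi> v'" by auto
    have "infinite (UNIV :: (nat \<times> nat) set)" by (simp add: finite_prod)
    then obtain w' where w': "w' \<notin> pverts H"
      using ex_new_if_finite[OF _ H.pair_finite_verts] by blast
    have "pair_iso (\<phi>(w' := w)) (subdivide H (u', v') w') (subdivide ?S (\<phi> u', \<phi> v') w)"
      using pair_iso_subdivide[OF \<phi> H.pair_wf_digraph e(1) w' S(3)] .
    then have "pair_iso (\<phi>(w' := w)) (subdivide H (u', v') w') T"
      using subdivide_suppress[OF uv] e by simp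
    moreover have "subdivision_pair (caterpillar ts) (subdivide H (u', v') w')"
      using subdivision_pair_divide[OF e(1) w' H] .
    ultimately show ?thesis using ts by blast
  qed
qed

section \<open>Membership in the family\<close>

lemma K_1_n_spine:
  assumes "K\<^bsub>1,n\<^esub> (with_proj T)" "2 \<le> n"
  shows "\<exists>P. heavy_ended_spine T P"
proof -
  obtain U W where fin: "finite (pverts T)" and UW: "pverts T = U \<union> W" "U \<inter> W = {}" "card U = 1"
      "card W = n" "parcs T = U \<times> W \<union> W \<times> U"
    using assms(1) unfolding complete_bipartite_digraph_pair_def by blast
  obtain z where z: "U = {z}" using UW(3) by (auto simp: card_1_singleton_iff)
  have nz: "nbrs T z = W" and nx: "\<And>x. x \<in> W \<Longrightarrow> nbrs T x = {z}"
    unfolding nbrs_def UW(5) z using UW(2) z by auto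
  then have dz: "deg T z = n" and dx: "\<And>x. x \<in> W \<Longrightarrow> deg T x = 1"
    using UW by (auto simp: deg_eq_card_nbrs)
  have "leaves T = W" using dz dx UW z assms(2) by (auto simp: leaves_def)
  then have "heavy_ended_spine T [z]"
    using UW z dz dx assms(2) by (auto simp: heavy_ended_spine_def vpath_def)
  then show ?thesis ..
qed

lemma spine_if_in_family:
  assumes "in_family_T T"
  shows "\<exists>P. heavy_ended_spine T P"
  using assms unfolding in_family_T_def
proof (elim disjE exE conjE)
  fix n :: nat assume "2 \<le> n" "K\<^bsub>1,n\<^esub> (with_proj T)"
  then show ?thesis using K_1_n_spine by blast
next
  fix G H assume G: "in_family_T' G" and H: "subdivision_pair G H"
    and iso: "digraph_iso (with_proj H) (with_proj T)"
  obtain ts where ts: "2 \<le> length ts" "1 \<le> hd ts" "sum_list (butlast ts) \<le> last ts" "G = caterpillar ts"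
    using G by (auto simp: in_family_T'_def)
  have pg: "pair_graph G" using pair_graph_caterpillar ts(4) by simp
  interpret H: pair_graph H using pair_graph.pair_graph_subdivision[OF pg H] .
  obtain P where P: "heavy_ended_spine H P"
    using subdivision_spine[OF H pg] caterpillar_spine[OF ts(1-3)] ts(4) by blast
  have "pair_wf_digraph H" by unfold_locales
  then show ?thesis
    using iso pair_iso_spine[OF _ _ P] digraph_iso_iff_pair_iso by blast
qed

context tree_graph
begin

lemma deg_pos:
  assumes "x \<in> pverts T" "2 \<le> card (pverts T)"
  shows "1 \<le> deg T x"
proof -
  have "pverts T \<noteq> {x}" using assms(2) by auto
  then obtain a where "a \<in> pverts T" "a \<noteq> x" using assms(1) by blast
  then obtain y where "y \<in> nbrs T x" using ex_nbr_toward[of x a] assms(1) by (auto simp: nbrs_def)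
  then show ?thesis using nbrs_finite by (auto simp: deg_eq_card_nbrs Suc_le_eq card_gt_0_iff)
qed

text \<open>
  All vertices other than \<open>z\<close> are leaves, and leaves are not adjacent to each other.
\<close>

lemma star_if_one_inner_vertex:
  assumes z: "z \<in> pverts T" and card: "3 \<le> card (pverts T)"
    and others: "\<And>y. y \<in> pverts T \<Longrightarrow> y \<noteq> z \<Longrightarrow> \<not> 2 \<le> deg T y"
  shows "\<exists>n\<ge>2. K\<^bsub>1,n\<^esub> (with_proj T)"
proof -
  let ?W = "pverts T - {z}"
  have leaf: "y \<in> leaves T" if "y \<in> ?W" for y
    using others[of y] deg_pos[of y] that card by (auto simp: leaves_def)
  have no_arc: "(a, b) \<notin> parcs T" if "a \<in> ?W" "b \<in> ?W" for a b
    using adjacent_leaves[of a b z] leaf that z by blast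
  have arc: "(b, z) \<in> parcs T" if b: "b \<in> ?W" for b
  proof -
    obtain y where y: "(b, y) \<in> parcs T" using ex_nbr_toward[of b z] b z by blast
    then have "y = z" using no_arc[of b y] b arcD[OF y] by blast
    then show ?thesis using y by simp
  qed
  have "parcs T = {z} \<times> ?W \<union> ?W \<times> {z}"
  proof (intro equalityI subsetI)
    fix e assume e: "e \<in> parcs T"
    obtain a b where ab: "e = (a, b)" by (cases e)
    then show "e \<in> {z} \<times> ?W \<union> ?W \<times> {z}" using e no_arc[of a b] arcD[of a b] by auto
  next
    fix e assume "e \<in> {z} \<times> ?W \<union> ?W \<times> {z}"
    then show "e \<in> parcs T" using arc arcs_symmetric by auto
  qed
  moreover have "pverts T = {z} \<union> ?W" using z by blast
  moreover have "card ?W = card (pverts T) - 1" using z by simp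
  moreover have "{z} \<inter> ?W = {}" "card {z} = 1" by auto
  ultimately have "K\<^bsub>1,card (pverts T) - 1\<^esub> (with_proj T)"
    unfolding complete_bipartite_digraph_pair_def using pair_finite_verts by blast
  moreover have "2 \<le> card (pverts T) - 1" using card by linarith
  ultimately show ?thesis by blast
qed

text \<open>
  Two vertices of degree at least 2 are needed as ends of the spine.  A star has only one.  In
  another tree a shortest spine either ends in a branch vertex, because its last vertex cannot be
  dropped, or is a single vertex and can be replaced by a path to any inner vertex.
\<close>

lemma in_family_if_spine:
  assumes P: "heavy_ended_spine T P" and card: "3 \<le> card (pverts T)"
  shows "in_family_T T"
proof (cases "\<exists>y \<in> pverts T. y \<noteq> hd P \<and> 2 \<le> deg T y")
  case False
  have "hd P \<in> pverts T" using P by (auto simp: heavy_ended_spine_def vpath_def vwalk_def)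
  then show ?thesis
    using star_if_one_inner_vertex[of "hd P"] False card by (auto simp: in_family_T_def)
next
  case True
  then obtain y where y: "y \<in> pverts T" "y \<noteq> hd P" "2 \<le> deg T y" by blast
  let ?R = "\<lambda>Q. heavy_ended_spine T Q \<and> hd Q = hd P"
  obtain Q where Q: "?R Q" and min: "\<And>Q'. ?R Q' \<Longrightarrow> length Q \<le> length Q'"
    using ex_has_least_nat[of ?R P length] P by blast
  have Qp: "vwalk Q (with_proj T)" "distinct Q" "Q \<noteq> []"
    using Q by (auto simp: heavy_ended_spine_def vpath_def)
  have zV: "hd P \<in> pverts T" using Q Qp by (metis hd_in_set vwalk_verts_in_verts with_proj_simps(1))
  have "\<exists>R. vpath R (with_proj T) \<and> 2 \<le> length R \<and> hd R = hd P \<and> 2 \<le> deg T (last R) \<and>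
    (\<forall>x\<in>pverts T. 3 \<le> deg T x \<longrightarrow> x \<in> set R)"
  proof (cases "length Q = 1")
    case True
    then have "Q = [hd P]" using Q by (cases Q) auto
    then have branch: "x = hd P" if "x \<in> pverts T" "3 \<le> deg T x" for x
      using Q that by (auto simp: heavy_ended_spine_def)
    obtain R where R: "vpath R (with_proj T)" "hd R = hd P" "last R = y"
      using ex_vpath[OF zV y(1)] .
    then have "R \<noteq> []" by (auto simp: vpath_def)
    then have "2 \<le> length R" "hd P \<in> set R"
      using R y(2) by (cases R; cases "tl R"; auto)+
    then show ?thesis using R y(3) branch by blast
  next
    case False
    then have len: "2 \<le> length Q" using Qp(3) by (cases Q; cases "tl Q") auto
    let ?B = "butlast Q"
    have bl: "Q = ?B @ [last Q]" using Qp(3) by simp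
    have Bne: "?B \<noteq> []" using len by (cases Q) auto
    have "vwalk ?B (with_proj T)" using vwalkI_append_l[OF Bne, of "[last Q]"] bl Qp(1) by metis
    moreover have "distinct ?B" using Qp(2) by (rule distinct_butlast)
    moreover have "hd ?B = hd Q" using Bne bl by (metis hd_append2)
    moreover have "\<not> ?R ?B" using min[of ?B] len by auto
    ultimately obtain x where x: "x \<in> pverts T" "3 \<le> deg T x" "x \<notin> set ?B"
      using Q by (auto simp: heavy_ended_spine_def vpath_def)
    then have "x \<in> set Q" using Q by (auto simp: heavy_ended_spine_def)
    then have "x = last Q" using x(3) bl by (metis Un_iff empty_iff insert_iff list.set set_append)
    then show ?thesis using Q len x(2) by (intro exI[of _ Q]) (auto simp: heavy_ended_spine_def)
  qed
  then obtain R where R: "vpath R (with_proj T)" "2 \<le> length R" "hd R = hd P" "2 \<le> deg T (last R)"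
    "\<forall>x\<in>pverts T. 3 \<le> deg T x \<longrightarrow> x \<in> set R" by blast
  have Rne: "R \<noteq> []" using R(2) by auto
  have "vpath (rev R) (with_proj T)"
    using R(1) pair_sym_arcs by (auto simp: vpath_def intro: vwalk_rev_ex)
  then obtain ts H \<phi> where ts: "2 \<le> length ts" "1 \<le> hd ts" "sum_list (butlast ts) \<le> last ts"
    and H: "subdivision_pair (caterpillar ts) H" and \<phi>: "pair_iso \<phi> H T"
    using subdivided_caterpillar_if_spine[of T "rev R"] R Rne P tree_graph_axioms
    by (auto simp: hd_rev last_rev heavy_ended_spine_def)
  interpret H: pair_graph H
    using pair_graph.pair_graph_subdivision[OF pair_graph_caterpillar H] .
  have "pair_wf_digraph H" by unfold_locales
  then have "digraph_iso (with_proj H) (with_proj T)"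
    using digraph_iso_iff_pair_iso \<phi> by blast
  then show ?thesis using ts H unfolding in_family_T_def in_family_T'_def by blast
qed

end

theorem theorem5p4:
  fixes T :: "'a pair_pre_digraph"
  assumes "undirected_tree T" and "card (pverts T) \<ge> 3"
  shows "int (gp_game' T) = int (num_leaves T) - int (max_degree T) + 2 \<longleftrightarrow> in_family_T T"
proof -
  interpret tree_graph T using tree_graph_if_undirected_tree[OF assms(1)] .
  have two: "2 \<le> card (pverts T)" using assms(2) by linarith
  have fin: "finite (deg T ` pverts T)" and ne: "deg T ` pverts T \<noteq> {}"
    using pair_finite_verts assms(2) by auto
  obtain v where v: "v \<in> pverts T" "max_degree T = deg T v"
    using Max_in[OF fin ne] by (auto simp: max_degree_def)
  have max: "deg T x \<le> max_degree T" if "x \<in> pverts T" for x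
    using Max_ge[OF fin] that by (auto simp: max_degree_def)
  have upper: "gp_game' T + deg T v \<le> card (leaves T) + 2"
    using gp_game'_le[OF v(1) two] .
  have "int (gp_game' T) = int (num_leaves T) - int (max_degree T) + 2 \<longleftrightarrow>
    card (leaves T) + 2 \<le> gp_game' T + deg T v"
    using upper v(2) by (auto simp: num_leaves_eq_card)
  also have "\<dots> \<longleftrightarrow> (\<exists>P. heavy_ended_spine T P)"
  proof
    assume "\<exists>P. heavy_ended_spine T P"
    then obtain P where P: "heavy_ended_spine T P" ..
    then have "hd P \<in> pverts T" by (auto simp: heavy_ended_spine_def vpath_def vwalk_def)
    then show "card (leaves T) + 2 \<le> gp_game' T + deg T v"
      using game_large_if_spine[OF P two] max[of "hd P"] v(2) by linarith
  qed (use spine_if_game_large[OF v(1) two] in blast)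
  also have "\<dots> \<longleftrightarrow> in_family_T T"
    using in_family_if_spine assms(2) spine_if_in_family by blast
  finally show ?thesis .
qed

end
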